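(* Let $r\colon\mathbb{R}^d\to\mathbb{R}\cup\{+\infty\}$ be a closed function, $f\colon\mathbb{R}^d\to\mathbb{R}$ locally Lipschitz, and $\varphi=f+r$. Suppose there are reals $\tau\ge0$, $\eta$ and $\mathsf{L}\ge0$ such that: (B1) one can generate i.i.d. realizations $\xi_0,\xi_1,\ldots\sim P$ from a probability space $(\Omega,\mathcal{F},P)$; (B2) there is an open convex set $U\supseteq\mathrm{dom}\,r$ and a measurable function $(x,y,\xi)\mapsto f_x(y,\xi)$ on $U\times U\times\Omega$ with $\mathbb{E}_\xi[f_x(x,\xi)]=f(x)$ for all $x\in U$ and $\mathbb{E}_\xi[f_x(y,\xi)-f(y)]\le\frac{\tau}{2}\|y-x\|^2$ for all $x,y\in U$; (B3) for all $x\in U$ and a.e. $\xi$, $f_x(\cdot,\xi)+r(\cdot)$ is $\eta$-weakly convex; (B4) there is a measurable $L\colon\Omega\to\mathbb{R}_+$ with $\sqrt{\mathbb{E}_\xi[L(\xi)^2]}\le\mathsf{L}$ and $f_x(x,\xi)-f_x(y,\xi)\le L(\xi)\|x-y\|$ for all $x,y\in U$ and a.e. $\xi$. Fix $T\ge0$, a real $\bar\rho>\max\{\tau+\eta,0\}$, reals $\beta_t>\bar\rho$ ($t=0,\ldots,T$), and $x_0\in U$. Define $x_{t+1}=\operatorname{argmin}_x\{r(x)+f_{x_t}(x,\xi_t)+\frac{\beta_t}{2}\|x-x_t\|^2\}$ for $t=0,\ldots,T$, and let $t^*\in\{0,\ldots,T\}$ be sampled independently with $\mathbb{P}(t^*=t)\propto\frac{\bar\rho-\tau-\eta}{\beta_t-\eta}$.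 Then for every $t\in\{0,\ldots,T\}$, $$\mathbb{E}\big[\varphi_{1/\bar\rho}(x_{t+1})\big]\le\mathbb{E}\big[\varphi_{1/\bar\rho}(x_t)\big]-\frac{\bar\rho-\tau-\eta}{2\bar\rho(\beta_t-\eta)}\mathbb{E}\big[\|\nabla\varphi_{1/\bar\rho}(x_t)\|^2\big]+\frac{2\bar\rho\mathsf{L}^2}{(\beta_t-\eta)(\beta_t-\bar\rho)},$$ and $$\mathbb{E}\|\nabla\varphi_{1/\bar\rho}(x_{t^*})\|^2\le\frac{\bar\rho\big(\varphi_{1/\bar\rho}(x_0)-\min\varphi\big)+2\bar\rho^2\mathsf{L}^2\sum_{t=0}^T\frac{1}{(\beta_t-\eta)(\beta_t-\bar\rho)}}{\sum_{t=0}^T\frac{\bar\rho-\tau-\eta}{2(\beta_t-\eta)}}.$$ In particular, if $\beta_t=\bar\rho+\gamma^{-1}\sqrt{T+1}$ for all $t$, for some real $\gamma>0$, then $$\mathbb{E}\|\nabla\varphi_{1/\bar\rho}(x_{t^*})\|^2\le\frac{2\big(\bar\rho(\varphi_{1/\bar\rho}(x_0)-\min\varphi)+2\bar\rho^2\mathsf{L}^2\gamma^2\big)}{\bar\rho-\tau-\eta}\cdot\left(\frac{\bar\rho-\eta}{T+1}+\frac{1}{\gamma\sqrt{T+1}}\right).$$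
   Context: A function $g$ is $\rho$-weakly convex (for a real $\rho$, possibly negative) if $x\mapsto g(x)+\frac{\rho}{2}\|x\|^2$ is convex; under the assumptions, $\varphi$ is $(\tau+\eta)$-weakly convex. For $\lambda>0$: $\varphi_\lambda(x)=\min_y\{\varphi(y)+\frac{1}{2\lambda}\|y-x\|^2\}$ (Moreau envelope) and $\mathrm{prox}_{\lambda\varphi}(x)=\operatorname{argmin}_y\{\varphi(y)+\frac{1}{2\lambda}\|y-x\|^2\}$; for $\bar\rho>0$ exceeding the weak convexity parameter of $\varphi$, $\varphi_{1/\bar\rho}$ is $C^1$ with $\nabla\varphi_{1/\bar\rho}(x)=\bar\rho\,(x-\mathrm{prox}_{\varphi/\bar\rho}(x))$. $\min\varphi$ denotes $\inf\varphi$. $\mathbb{E}$ is expectation over all randomness. *)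

theory Defs
  imports "HOL-Analysis.Analysis" "HOL-Probability.Probability"
begin

text \<open>Convexity of an extended-real-valued function on the whole space
  (functions never take the value minus infinity in our uses).\<close>
definition ext_convex :: "('a::real_vector \<Rightarrow> ereal) \<Rightarrow> bool" where
  "ext_convex h \<longleftrightarrow> (\<forall>x y u. 0 \<le> u \<and> u \<le> 1 \<longrightarrow>
      h ((1 - u) *\<^sub>R x + u *\<^sub>R y) \<le> ereal (1 - u) * h x + ereal u * h y)"

definition weakly_convex :: "real \<Rightarrow> ('a::real_inner \<Rightarrow> ereal) \<Rightarrow> bool" where
  "weakly_convex \<rho> g \<longleftrightarrow> ext_convex (\<lambda>x. g x + ereal (\<rho> / 2 * (norm x)\<^sup>2))"

definition closed_fun :: "('a::topological_space \<Rightarrow> ereal) \<Rightarrow> bool" where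
  "closed_fun g \<longleftrightarrow> closed {(x, t::real). g x \<le> ereal t}"

definition dom_fun :: "('a \<Rightarrow> ereal) \<Rightarrow> 'a set" where
  "dom_fun g = {x. g x < \<infinity>}"

definition locally_lipschitz :: "('a::metric_space \<Rightarrow> real) \<Rightarrow> bool" where
  "locally_lipschitz f \<longleftrightarrow>
     (\<forall>x. \<exists>e>0. \<exists>K. \<forall>y\<in>ball x e. \<forall>z\<in>ball x e. \<bar>f y - f z\<bar> \<le> K * dist y z)"

definition moreau_env :: "('a::real_normed_vector \<Rightarrow> ereal) \<Rightarrow> real \<Rightarrow> 'a \<Rightarrow> ereal" where
  "moreau_env \<phi> lam x = (INF y. \<phi> y + ereal (1 / (2 * lam) * (norm (y - x))\<^sup>2))"

definition grad :: "('a::real_inner \<Rightarrow> real) \<Rightarrow> 'a \<Rightarrow> 'a" where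
  "grad g x = (THE D. GDERIV g x :> D)"

end

theory Submission
  imports Defs
begin

text \<open>The function \<open>\<phi> = f + r\<close> is \<open>(\<tau> + \<eta>)\<close>-weakly convex, since \<open>f\<close> agrees at \<open>x\<close> with the mean
  model \<open>E[F x y \<xi>]\<close>, which overestimates it by at most \<open>\<tau>/2 |y - x|\<^sup>2\<close>. Hence its proximal objective is
  strongly convex, \<open>prox\<close> is Lipschitz and the Moreau envelope has gradient \<open>\<rho> (x - prox x)\<close>.

  Let \<open>y = prox (X t)\<close> and \<open>z = X (t + 1)\<close>. Comparing the strongly convex objective that \<open>z\<close> minimizes at
  \<open>z\<close> and \<open>y\<close>, the proximal objective at \<open>y\<close> and \<open>z\<close>, and using that \<open>f\<close> is \<open>Lc\<close>-Lipschitz on \<open>U\<close>,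
  gives a pointwise bound on \<open>|y - z|\<^sup>2\<close>. Since \<open>X t\<close> is independent of the sample \<open>\<xi> t\<close>, this integrates to
  \<open>E|y - z|\<^sup>2 \<le> (\<beta> + \<tau> - \<rho>)/(\<beta> - \<eta>) E|X t - y|\<^sup>2 + 4 Lc\<^sup>2 / ((\<beta> - \<eta>)(\<beta> - \<rho>))\<close>, and
  \<open>env z \<le> \<phi> y + \<rho>/2 |y - z|\<^sup>2\<close> turns this into the expected descent of the envelope, which is then summed.\<close>

section \<open>Weakly convex functions and their minimizers\<close>

lemma norm_sq_convex_combination:
  fixes x y :: "'a::real_inner"
  shows "(norm ((1 - u) *\<^sub>R x + u *\<^sub>R y))\<^sup>2
    = (1 - u) * (norm x)\<^sup>2 + u * (norm y)\<^sup>2 - u * (1 - u) * (norm (x - y))\<^sup>2"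
  unfolding power2_norm_eq_inner
  by (simp add: inner_simps inner_commute algebra_simps)

text \<open>Expanding the quadratic by the identity for convex combinations turns convexity of
  \<open>g + \<kappa>/2 |x|^2\<close> into an inequality for \<open>g\<close> itself, with a defect
  proportional to \<open>u * (1 - u)\<close>. Finite values keep the arithmetic in the
  reals.\<close>

lemma weakly_convexD:
  fixes g :: "'a::real_inner \<Rightarrow> ereal"
  assumes "weakly_convex \<kappa> g" "g x = ereal a" "g y = ereal b" "0 \<le> u" "u \<le> 1"
  shows "g ((1 - u) *\<^sub>R x + u *\<^sub>R y)
    \<le> ereal ((1 - u) * a + u * b + \<kappa> / 2 * (u * (1 - u) * (norm (x - y))\<^sup>2))"
proof -
  let ?z = "(1 - u) *\<^sub>R x + u *\<^sub>R y"
  have "g ?z + ereal (\<kappa> / 2 * (norm ?z)\<^sup>2)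
    \<le> ereal ((1 - u) * (a + \<kappa> / 2 * (norm x)\<^sup>2) + u * (b + \<kappa> / 2 * (norm y)\<^sup>2))"
    using assms(1)[unfolded weakly_convex_def ext_convex_def, rule_format, of u x y] assms(2-)
    by simp
  then have "g ?z \<le> ereal ((1 - u) * (a + \<kappa> / 2 * (norm x)\<^sup>2) + u * (b + \<kappa> / 2 * (norm y)\<^sup>2)
      - \<kappa> / 2 * (norm ?z)\<^sup>2)"
    by (cases "g ?z") (auto simp: algebra_simps)
  also have "(1 - u) * (a + \<kappa> / 2 * (norm x)\<^sup>2) + u * (b + \<kappa> / 2 * (norm y)\<^sup>2)
      - \<kappa> / 2 * (norm ?z)\<^sup>2 = (1 - u) * a + u * b + \<kappa> / 2 * (u * (1 - u) * (norm (x - y))\<^sup>2)"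
    unfolding norm_sq_convex_combination by (simp add: field_simps)
  finally show ?thesis .
qed

text \<open>Finite values and \<open>0 < u < 1\<close> suffice: an infinite value at an endpoint
  makes the right-hand side infinite, and for \<open>u = 0\<close> or \<open>u = 1\<close> the
  vanishing coefficient times infinity is zero in \<open>ereal\<close>.\<close>

lemma weakly_convexI:
  fixes g :: "'a::real_inner \<Rightarrow> ereal"
  assumes "\<And>x. g x \<noteq> -\<infinity>"
    and "\<And>x y a b u. g x = ereal a \<Longrightarrow> g y = ereal b \<Longrightarrow> 0 < u \<Longrightarrow> u < 1 \<Longrightarrow>
      g ((1 - u) *\<^sub>R x + u *\<^sub>R y)
        \<le> ereal ((1 - u) * a + u * b + \<kappa> / 2 * (u * (1 - u) * (norm (x - y))\<^sup>2))"
  shows "weakly_convex \<kappa> g"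
  unfolding weakly_convex_def ext_convex_def
proof (intro allI impI)
  fix x y :: 'a and u :: real
  assume u: "0 \<le> u \<and> u \<le> 1"
  let ?z = "(1 - u) *\<^sub>R x + u *\<^sub>R y"
  let ?q = "\<lambda>x. ereal (\<kappa> / 2 * (norm x)\<^sup>2)"
  consider "u = 0" | "u = 1" | "0 < u" "u < 1" "g x = \<infinity> \<or> g y = \<infinity>"
    | a b where "0 < u" "u < 1" "g x = ereal a" "g y = ereal b"
    using u assms(1)[of x] assms(1)[of y] by (cases "g x"; cases "g y") fastforce+
  then show "g ?z + ?q ?z \<le> ereal (1 - u) * (g x + ?q x) + ereal u * (g y + ?q y)"
  proof cases
    case 3
    then have "ereal (1 - u) * (g x + ?q x) + ereal u * (g y + ?q y) = \<infinity>"
      using assms(1)[of x] assms(1)[of y] by (cases "g x"; cases "g y") auto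
    then show ?thesis by (simp only: ereal_less_eq(1))
  next
    case 4
    have "g ?z + ?q ?z \<le> ereal ((1 - u) * a + u * b + \<kappa> / 2 * (u * (1 - u) * (norm (x - y))\<^sup>2)) + ?q ?z"
      using assms(2)[OF 4(3,4,1,2)] by (rule add_right_mono)
    also have "\<dots> = ereal ((1 - u) * (a + \<kappa> / 2 * (norm x)\<^sup>2) + u * (b + \<kappa> / 2 * (norm y)\<^sup>2))"
      unfolding norm_sq_convex_combination by (simp add: field_simps)
    finally show ?thesis by (simp add: 4)
  qed (simp_all flip: zero_ereal_def one_ereal_def)
qed

text \<open>Shifting by \<open>c\<close> commutes with convex combinations, so the quadratic
  contributes exactly its own defect. With \<open>\<rho> > \<kappa>\<close> the resulting parameter
  is negative, which is strong convexity.\<close>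

lemma weakly_convex_add_norm_sq:
  fixes g :: "'a::real_inner \<Rightarrow> ereal"
  assumes "weakly_convex \<kappa> g" "\<And>x. g x \<noteq> -\<infinity>"
  shows "weakly_convex (\<kappa> - \<rho>) (\<lambda>y. g y + ereal (\<rho> / 2 * (norm (y - c))\<^sup>2))"
proof (rule weakly_convexI)
  fix x y :: 'a and a b u :: real
  let ?z = "(1 - u) *\<^sub>R x + u *\<^sub>R y"
  let ?q = "\<lambda>x. \<rho> / 2 * (norm (x - c))\<^sup>2"
  assume h: "g x + ereal (?q x) = ereal a" "g y + ereal (?q y) = ereal b" and u: "0 < u" "u < 1"
  obtain a' b' where ab: "g x = ereal a'" "g y = ereal b'"
    using h by (cases "g x"; cases "g y") auto
  have z: "?z - c = (1 - u) *\<^sub>R (x - c) + u *\<^sub>R (y - c)"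
    by (simp add: algebra_simps)
  have "g ?z + ereal (?q ?z)
      \<le> ereal ((1 - u) * a' + u * b' + \<kappa> / 2 * (u * (1 - u) * (norm (x - y))\<^sup>2)) + ereal (?q ?z)"
    using weakly_convexD[OF assms(1) ab, of u] u by (intro add_right_mono) auto
  also have "\<dots> = ereal ((1 - u) * a + u * b + (\<kappa> - \<rho>) / 2 * (u * (1 - u) * (norm (x - y))\<^sup>2))"
  proof -
    have a: "a = a' + ?q x" and b: "b = b' + ?q y" using h ab by auto
    show ?thesis
      unfolding z a b norm_sq_convex_combination
      by (simp add: algebra_simps add_divide_distrib diff_divide_distrib)
  qed
  finally show "g ?z + ereal (?q ?z)
      \<le> ereal ((1 - u) * a + u * b + (\<kappa> - \<rho>) / 2 * (u * (1 - u) * (norm (x - y))\<^sup>2))" .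
qed (use assms(2) in \<open>auto\<close>)

text \<open>Comparing \<open>p\<close> with the points of the segment towards \<open>y\<close> and
  dividing by \<open>u\<close> gives the bound with the extra factor \<open>1 - u\<close>, which
  disappears as \<open>u\<close> tends to 0.\<close>

lemma quadratic_growth_at_minimizer:
  fixes g :: "'a::real_inner \<Rightarrow> ereal"
  assumes "weakly_convex (-\<mu>) g" "\<And>y. g p \<le> g y" "g p = ereal a" "g y = ereal b"
  shows "a + \<mu> / 2 * (norm (y - p))\<^sup>2 \<le> b"
proof -
  define N where "N = \<mu> / 2 * (norm (y - p))\<^sup>2"
  have *: "a + (1 - u) * N \<le> b" if "0 < u" "u \<le> 1" for u
  proof -
    have "ereal a \<le> ereal ((1 - u) * a + u * b + (-\<mu>) / 2 * (u * (1 - u) * (norm (p - y))\<^sup>2))"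
      using order_trans[OF assms(2) weakly_convexD[OF assms(1,3,4), of u]] assms(3) that by simp
    then have "u * (a + (1 - u) * N) \<le> u * b"
      unfolding N_def by (simp add: field_simps norm_minus_commute)
    then show ?thesis using that by simp
  qed
  have "((\<lambda>u. a + (1 - u) * N) \<longlongrightarrow> a + (1 - 0) * N) (at_right 0)"
    by (intro tendsto_intros)
  moreover have "eventually (\<lambda>u. a + (1 - u) * N \<le> b) (at_right 0)"
    using * by (intro eventually_at_rightI[of 0 1]) auto
  ultimately have "a + (1 - 0) * N \<le> b"
    by (intro tendsto_upperbound) auto
  then show ?thesis by (simp add: N_def)
qed

section \<open>Closed functions and existence of minimizers\<close>

lemma closed_fun_closed_sublevel:
  assumes "closed_fun g"
  shows "closed {x. g x \<le> ereal t}"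
proof -
  have "{x. g x \<le> ereal t} = (\<lambda>x. (x, t)) -` {(x, t::real). g x \<le> ereal t}"
    by auto
  then show ?thesis
    using closed_vimage[OF assms[unfolded closed_fun_def], of "\<lambda>x. (x, t)"]
    by (simp add: continuous_intros)
qed

lemma closed_fun_add_continuous:
  fixes h :: "'a::topological_space \<Rightarrow> real"
  assumes "closed_fun g" "continuous_on UNIV h"
  shows "closed_fun (\<lambda>x. g x + ereal (h x))"
proof -
  have "g x + ereal (h x) \<le> ereal t \<longleftrightarrow> g x \<le> ereal (t - h x)" for x t
    by (cases "g x") auto
  then have eq: "{(x, t::real). g x + ereal (h x) \<le> ereal t}
      = (\<lambda>p. (fst p, snd p - h (fst p))) -` {(x, t::real). g x \<le> ereal t}"
    by auto
  have "continuous_on UNIV (\<lambda>p::'a \<times> real. (fst p, snd p - h (fst p)))"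
    by (intro continuous_intros continuous_on_compose2[OF assms(2)]) auto
  then show ?thesis
    unfolding closed_fun_def eq by (rule closed_vimage[OF assms(1)[unfolded closed_fun_def]])
qed

text \<open>The closed sublevel sets at levels reached on \<open>K\<close> are nested, hence have
  the finite intersection property in \<open>K\<close>. A common point lies below every real upper
  bound of every value on \<open>K\<close>.\<close>

lemma closed_fun_attains_min_on_compact:
  fixes g :: "'a::t2_space \<Rightarrow> ereal"
  assumes "closed_fun g" "compact K" "K \<noteq> {}"
  shows "\<exists>p\<in>K. \<forall>y\<in>K. g p \<le> g y"
proof (cases "\<forall>y\<in>K. g y = \<infinity>")
  case True
  then show ?thesis using assms(3) by auto
next
  case False
  define A where "A = {t::real. \<exists>y\<in>K. g y \<le> ereal t}"
  have "K \<inter> (\<Inter>t\<in>A. {x. g x \<le> ereal t}) \<noteq> {}"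
  proof (rule compact_imp_fip_image[OF assms(2)])
    fix B assume B: "finite B" "B \<subseteq> A"
    show "K \<inter> (\<Inter>t\<in>B. {x. g x \<le> ereal t}) \<noteq> {}"
    proof (cases "B = {}")
      case False
      then have "Min B \<in> A" using B Min_in[of B] by blast
      then obtain y where "y \<in> K" "g y \<le> ereal (Min B)"
        by (auto simp: A_def)
      moreover have "ereal (Min B) \<le> ereal t" if "t \<in> B" for t
        using that B by simp
      ultimately show ?thesis by (blast intro: order_trans)
    qed (use assms(3) in simp)
  qed (use assms(1) closed_fun_closed_sublevel in blast)
  then obtain p where p: "p \<in> K" "\<And>t. t \<in> A \<Longrightarrow> g p \<le> ereal t"
    by auto
  have "g p \<le> g y" if "y \<in> K" for y
  proof (rule ereal_le_real)
    fix t assume "g y \<le> ereal t"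
    then show "g p \<le> ereal t" using p(2)[of t] that by (auto simp: A_def)
  qed
  then show ?thesis using p(1) by blast
qed

text \<open>Strong convexity forces \<open>g\<close> to be at least \<open>g q\<close> outside a
  large ball about \<open>q\<close>, so a minimizer over that compact ball is global.\<close>

lemma strongly_convex_attains_min:
  fixes g :: "'a::euclidean_space \<Rightarrow> ereal"
  assumes "weakly_convex (-\<mu>) g" "\<mu> > 0" "closed_fun g" "\<And>x. g x \<noteq> -\<infinity>" "g q < \<infinity>"
  shows "\<exists>p. \<forall>y. g p \<le> g y"
proof -
  obtain a where a: "g q = ereal a" using assms(4)[of q] assms(5) by (cases "g q") auto
  obtain p1 where p1: "p1 \<in> cball q 1" "\<forall>y\<in>cball q 1. g p1 \<le> g y"
    using closed_fun_attains_min_on_compact[OF assms(3), of "cball q 1"] by auto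
  then have "g p1 \<le> ereal a" by (simp flip: a)
  then obtain m where m: "g p1 = ereal m" "m \<le> a"
    using assms(4)[of p1] by (cases "g p1") auto
  \<comment> \<open>The radius solves \<open>\<mu> / 2 * (R - 1) = a - m\<close>: a point
    \<open>y\<close> with \<open>g y < g q\<close> at distance \<open>D\<close> from
    \<open>q\<close> will satisfy \<open>\<mu> / 2 * (D - 1) \<le> a - m\<close>.\<close>
  define R where "R = 1 + 2 * (a - m) / \<mu>"
  have R1: "1 \<le> R" using m assms(2) by (simp add: R_def)
  have far: "g q \<le> g y" if y: "y \<notin> cball q R" for y
  proof (rule ccontr)
    assume "\<not> g q \<le> g y"
    then obtain b where b: "g y = ereal b" "b < a"
      using assms(4)[of y] a by (cases "g y") auto
    define D where "D = norm (y - q)"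
    have D: "R < D" using y by (simp add: D_def dist_norm norm_minus_commute)
    \<comment> \<open>This choice puts \<open>z\<close> on the unit sphere about \<open>q\<close>,
      where \<open>g\<close> is at least \<open>m\<close>.\<close>
    define u where "u = 1 / D"
    have u: "0 < u" "u < 1" "u * D = 1" using D R1 by (auto simp: u_def)
    define z where "z = (1 - u) *\<^sub>R q + u *\<^sub>R y"
    have "z - q = u *\<^sub>R (y - q)" by (simp add: z_def algebra_simps)
    then have "norm (z - q) = 1" using u by (simp add: D_def)
    then have "g p1 \<le> g z" using p1(2) by (simp add: dist_norm norm_minus_commute)
    also have "g z \<le> ereal ((1 - u) * a + u * b + (-\<mu>) / 2 * (u * (1 - u) * D\<^sup>2))"
      using weakly_convexD[OF assms(1) a b(1), of u] u
      by (simp add: z_def D_def norm_minus_commute)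
    finally have "m \<le> (1 - u) * a + u * b - \<mu> / 2 * (u * (1 - u) * D\<^sup>2)"
      by (simp add: m)
    also have "u * (1 - u) * D\<^sup>2 = (u * D) * D - (u * D) * (u * D)"
      by (simp add: power2_eq_square algebra_simps)
    also have "\<dots> = D - 1" by (simp add: u)
    also have "(1 - u) * a + u * b \<le> a"
      using mult_left_mono[of b a u] u b by (simp add: algebra_simps)
    finally have "\<mu> / 2 * (D - 1) \<le> a - m" by simp
    then have "D \<le> R" using assms(2) by (simp add: R_def field_simps)
    with D show False by simp
  qed
  obtain p where p: "\<forall>y\<in>cball q R. g p \<le> g y"
    using closed_fun_attains_min_on_compact[OF assms(3), of "cball q R"] R1 by force
  have "g p \<le> g y" for y
  proof (cases "y \<in> cball q R")
    case False
    have "g p \<le> g q" using p R1 by simp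
    then show ?thesis using far[OF False] by (rule order_trans)
  qed (use p in blast)
  then show ?thesis by blast
qed

section \<open>The proximal map and the Moreau envelope\<close>

locale proximal =
  fixes \<phi> :: "'a::euclidean_space \<Rightarrow> ereal" and \<kappa> \<rho> :: real
  assumes phi_weakly_convex: "weakly_convex \<kappa> \<phi>"
    and phi_closed: "closed_fun \<phi>"
    and phi_not_MInf: "\<And>x. \<phi> x \<noteq> -\<infinity>"
    and phi_proper: "\<exists>x. \<phi> x < \<infinity>"
    and kappa_less_rho: "\<kappa> < \<rho>"
    and rho_pos: "0 < \<rho>"
begin

definition prox :: "'a \<Rightarrow> 'a" where
  "prox x = (SOME p. \<forall>y. \<phi> p + ereal (\<rho> / 2 * (norm (p - x))\<^sup>2) \<le> \<phi> y + ereal (\<rho> / 2 * (norm (y - x))\<^sup>2))"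

definition env :: "'a \<Rightarrow> real" where
  "env x = real_of_ereal (moreau_env \<phi> (1 / \<rho>) x)"

text \<open>The Lipschitz constant of \<open>prox\<close>.\<close>

definition lipc :: real where
  "lipc = \<rho> / (\<rho> - \<kappa>)"

lemma lipc_pos: "0 < lipc"
  using kappa_less_rho rho_pos by (simp add: lipc_def)

lemma weakly_convex_prox_objective:
  "weakly_convex (-(\<rho> - \<kappa>)) (\<lambda>y. \<phi> y + ereal (\<rho> / 2 * (norm (y - x))\<^sup>2))"
  using weakly_convex_add_norm_sq[OF phi_weakly_convex phi_not_MInf, of \<rho> x] by simp

lemma prox_minimizes:
  "\<phi> (prox x) + ereal (\<rho> / 2 * (norm (prox x - x))\<^sup>2) \<le> \<phi> y + ereal (\<rho> / 2 * (norm (y - x))\<^sup>2)"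
proof -
  obtain q where q: "\<phi> q < \<infinity>" using phi_proper by blast
  have "\<exists>p. \<forall>y. \<phi> p + ereal (\<rho> / 2 * (norm (p - x))\<^sup>2) \<le> \<phi> y + ereal (\<rho> / 2 * (norm (y - x))\<^sup>2)"
  proof (rule strongly_convex_attains_min[OF weakly_convex_prox_objective])
    show "closed_fun (\<lambda>y. \<phi> y + ereal (\<rho> / 2 * (norm (y - x))\<^sup>2))"
      by (intro closed_fun_add_continuous phi_closed continuous_intros)
    show "\<phi> q + ereal (\<rho> / 2 * (norm (q - x))\<^sup>2) < \<infinity>" using q by auto
  qed (use kappa_less_rho phi_not_MInf in auto)
  then show ?thesis unfolding prox_def by (rule someI2_ex) blast
qed

lemma phi_prox: "\<phi> (prox x) = ereal (real_of_ereal (\<phi> (prox x)))"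
proof -
  obtain q where "\<phi> q < \<infinity>" using phi_proper by blast
  with prox_minimizes[of x q] phi_not_MInf[of "prox x"] show ?thesis
    by (cases "\<phi> (prox x)"; cases "\<phi> q") auto
qed

lemma moreau_env_eq:
  "moreau_env \<phi> (1 / \<rho>) x = ereal (real_of_ereal (\<phi> (prox x)) + \<rho> / 2 * (norm (prox x - x))\<^sup>2)"
proof -
  have "moreau_env \<phi> (1 / \<rho>) x = \<phi> (prox x) + ereal (\<rho> / 2 * (norm (prox x - x))\<^sup>2)"
    unfolding moreau_env_def using prox_minimizes[of x]
    by (intro antisym INF_greatest INF_lower2[of "prox x"]) auto
  then show ?thesis
    unfolding plus_ereal.simps(1)[symmetric] phi_prox[symmetric] .
qed

lemma env_eq: "env x = real_of_ereal (\<phi> (prox x)) + \<rho> / 2 * (norm (prox x - x))\<^sup>2"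
  unfolding env_def moreau_env_eq by simp

lemma moreau_env_eq_env: "moreau_env \<phi> (1 / \<rho>) x = ereal (env x)"
  unfolding env_eq moreau_env_eq ..

text \<open>The proximal objective is strongly convex with modulus \<open>\<rho> - \<kappa>\<close>
  and has minimal value \<open>env x\<close>, so it grows quadratically away from
  \<open>prox x\<close>.\<close>

lemma prox_growth:
  assumes "\<phi> y = ereal b"
  shows "env x + (\<rho> - \<kappa>) / 2 * (norm (y - prox x))\<^sup>2 \<le> b + \<rho> / 2 * (norm (y - x))\<^sup>2"
proof (rule quadratic_growth_at_minimizer[OF weakly_convex_prox_objective prox_minimizes])
  show "\<phi> (prox x) + ereal (\<rho> / 2 * (norm (prox x - x))\<^sup>2) = ereal (env x)"
    unfolding env_eq plus_ereal.simps(1)[symmetric] phi_prox[symmetric] ..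
qed (simp add: assms)

lemma env_le:
  assumes "\<phi> y = ereal b"
  shows "env x \<le> b + \<rho> / 2 * (norm (y - x))\<^sup>2"
proof -
  have "0 \<le> (\<rho> - \<kappa>) / 2 * (norm (y - prox x))\<^sup>2" using kappa_less_rho by simp
  with prox_growth[OF assms, of x] show ?thesis by linarith
qed

text \<open>Each of the two proximal objectives is tested at the minimizer of the other. Adding the
  growth bounds cancels the values of \<open>\<phi>\<close> and leaves an inner product, to which
  Cauchy-Schwarz applies.\<close>

lemma prox_lipschitz: "norm (prox x - prox y) \<le> lipc * norm (x - y)"
proof -
  define p q where "p = prox x" and "q = prox y"
  define N where "N = (norm (p - q))\<^sup>2"
  have N: "(norm (q - p))\<^sup>2 = N" by (simp add: N_def norm_minus_commute)
  have "env x + (\<rho> - \<kappa>) / 2 * N \<le> real_of_ereal (\<phi> q) + \<rho> / 2 * (norm (q - x))\<^sup>2"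
    using prox_growth[OF phi_prox, of x y] N by (simp add: p_def q_def)
  moreover have "env y + (\<rho> - \<kappa>) / 2 * N \<le> real_of_ereal (\<phi> p) + \<rho> / 2 * (norm (p - y))\<^sup>2"
    using prox_growth[OF phi_prox, of y x] by (simp add: N_def p_def q_def)
  moreover have "(norm (q - x))\<^sup>2 + (norm (p - y))\<^sup>2 - (norm (p - x))\<^sup>2 - (norm (q - y))\<^sup>2
      = 2 * ((p - q) \<bullet> (x - y))"
    unfolding power2_norm_eq_inner by (simp add: inner_simps inner_commute)
  then have "\<rho> / 2 * ((norm (q - x))\<^sup>2 + (norm (p - y))\<^sup>2 - (norm (p - x))\<^sup>2 - (norm (q - y))\<^sup>2)
      = \<rho> * ((p - q) \<bullet> (x - y))" by simp
  ultimately have "(\<rho> - \<kappa>) * N \<le> \<rho> * ((p - q) \<bullet> (x - y))"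
    unfolding env_eq p_def[symmetric] q_def[symmetric] by argo
  also have "\<dots> \<le> \<rho> * (norm (p - q) * norm (x - y))"
    using rho_pos norm_cauchy_schwarz by (intro mult_left_mono) auto
  finally have *: "norm (p - q) * ((\<rho> - \<kappa>) * norm (p - q)) \<le> norm (p - q) * (\<rho> * norm (x - y))"
    by (simp add: N_def power2_eq_square algebra_simps)
  show ?thesis
  proof (cases "norm (p - q) = 0")
    case True
    then show ?thesis using lipc_pos by (simp flip: p_def q_def)
  next
    case False
    with * have "(\<rho> - \<kappa>) * norm (p - q) \<le> \<rho> * norm (x - y)" by simp
    then show ?thesis
      using kappa_less_rho by (simp add: lipc_def field_simps flip: p_def q_def)
  qed
qed

section \<open>Differentiability and growth of the Moreau envelope\<close>

lemma env_upper:
  "env y - env x \<le> \<rho> * ((x - prox x) \<bullet> (y - x)) + \<rho> / 2 * (norm (y - x))\<^sup>2"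
proof -
  have "(norm (prox x - y))\<^sup>2 - (norm (prox x - x))\<^sup>2 = 2 * ((x - prox x) \<bullet> (y - x)) + (norm (y - x))\<^sup>2"
    unfolding power2_norm_eq_inner by (simp add: inner_simps inner_commute)
  then have "\<rho> / 2 * ((norm (prox x - y))\<^sup>2 - (norm (prox x - x))\<^sup>2)
      = \<rho> / 2 * (2 * ((x - prox x) \<bullet> (y - x)) + (norm (y - x))\<^sup>2)" by simp
  then show ?thesis
    using env_le[OF phi_prox, of y x] env_eq[of x] by (simp add: algebra_simps)
qed

text \<open>The upper estimate tests \<open>prox x\<close> in the problem defining
  \<open>env y\<close>. The lower one is the same estimate with \<open>x\<close> and
  \<open>y\<close> exchanged, where replacing \<open>y - prox y\<close> by \<open>x - prox x\<close>
  costs a quadratic error because \<open>prox\<close> is Lipschitz.\<close>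

lemma env_quadratic_approx:
  "\<bar>env y - env x - \<rho> * ((x - prox x) \<bullet> (y - x))\<bar> \<le> \<rho> * (1 + lipc) * (norm (y - x))\<^sup>2"
proof -
  define N where "N = (norm (y - x))\<^sup>2"
  have N: "N \<ge> 0" by (simp add: N_def)
  have "(prox y - prox x) \<bullet> (y - x) \<le> norm (prox y - prox x) * norm (y - x)"
    by (rule norm_cauchy_schwarz)
  also have "\<dots> \<le> lipc * norm (y - x) * norm (y - x)"
    by (intro mult_right_mono prox_lipschitz) auto
  finally have "(prox y - prox x) \<bullet> (y - x) \<le> lipc * N"
    by (simp add: N_def power2_eq_square mult_ac)
  then have c: "\<rho> * ((prox y - prox x) \<bullet> (y - x)) \<le> \<rho> * (lipc * N)"
    using rho_pos by (intro mult_left_mono) auto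
  have "(y - prox y) \<bullet> (x - y) = - ((x - prox x) \<bullet> (y - x)) - N + (prox y - prox x) \<bullet> (y - x)"
    unfolding N_def power2_norm_eq_inner by (simp add: inner_simps inner_commute)
  then have "\<rho> * ((y - prox y) \<bullet> (x - y))
      = - (\<rho> * ((x - prox x) \<bullet> (y - x))) - \<rho> * N + \<rho> * ((prox y - prox x) \<bullet> (y - x))"
    by (simp only: distrib_left right_diff_distrib mult_minus_right)
  then have "- (env y - env x - \<rho> * ((x - prox x) \<bullet> (y - x))) \<le> \<rho> * (lipc * N)"
    using env_upper[of x y, unfolded norm_minus_commute[of x y], folded N_def] c
      mult_nonneg_nonneg[of \<rho> N] rho_pos N by linarith
  moreover have "env y - env x - \<rho> * ((x - prox x) \<bullet> (y - x)) \<le> \<rho> / 2 * N"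
    using env_upper[of y x] by (simp add: N_def)
  moreover have "0 \<le> \<rho> * N" "0 \<le> \<rho> * (lipc * N)" using rho_pos N lipc_pos by simp_all
  ultimately show ?thesis unfolding N_def[symmetric] by (simp add: algebra_simps abs_le_iff)
qed

lemma env_GDERIV: "GDERIV env x :> \<rho> *\<^sub>R (x - prox x)"
  unfolding gderiv_def
proof (rule has_derivativeI_sandwich[of 1])
  show "bounded_linear (\<lambda>h. h \<bullet> \<rho> *\<^sub>R (x - prox x))"
    by (rule bounded_linear_inner_left)
  show "norm (env y - env x - (y - x) \<bullet> \<rho> *\<^sub>R (x - prox x)) / norm (y - x)
      \<le> \<rho> * (1 + lipc) * norm (y - x)" if "y \<noteq> x" for y
    using env_quadratic_approx[of y x] that
    by (simp add: inner_commute divide_le_eq power2_eq_square mult_ac)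
  have "((\<lambda>y. \<rho> * (1 + lipc) * norm (y - x)) \<longlongrightarrow> \<rho> * (1 + lipc) * norm (x - x)) (at x)"
    by (intro tendsto_intros)
  then show "((\<lambda>y. \<rho> * (1 + lipc) * norm (y - x)) \<longlongrightarrow> 0) (at x)" by simp
qed simp

lemma grad_env: "grad env x = \<rho> *\<^sub>R (x - prox x)"
  unfolding grad_def
proof (rule the_equality[where P = "\<lambda>D. GDERIV env x :> D", OF env_GDERIV])
  fix D assume "GDERIV env x :> D"
  then have "(\<lambda>h. h \<bullet> D) = (\<lambda>h. h \<bullet> (\<rho> *\<^sub>R (x - prox x)))"
    using env_GDERIV[of x] unfolding gderiv_def by (rule has_derivative_unique)
  then show "D = \<rho> *\<^sub>R (x - prox x)"
    by (metis inner_commute vector_eq_rdot)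
qed

lemma continuous_on_prox: "continuous_on UNIV prox"
proof (rule lipschitz_on_continuous_on)
  show "lipc-lipschitz_on UNIV prox"
    using prox_lipschitz lipc_pos by (intro lipschitz_onI) (auto simp: dist_norm)
qed

lemma continuous_on_env: "continuous_on UNIV env"
proof (intro continuous_at_imp_continuous_on ballI)
  fix x show "isCont env x"
    using env_GDERIV[of x] unfolding gderiv_def by (rule has_derivative_continuous)
qed

text \<open>Growth at most quadratic in the distance from a fixed \<open>c\<close>: with
  \<open>c = x0\<close>, finite second moments of the iterates make the squared displacement
  integrable. The bound on \<open>env\<close> that follows serves the same purpose.\<close>

lemma prox_displacement_sq_le:
  "(norm (x - prox x))\<^sup>2 \<le> 2 * (norm (c - prox c))\<^sup>2 + 2 * (1 + lipc)\<^sup>2 * (norm (x - c))\<^sup>2"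
proof -
  have "norm (x - prox x) \<le> norm (c - prox c) + norm (x - c) + norm (prox x - prox c)"
    using norm_triangle_ineq4[of "(c - prox c) + (x - c)" "prox x - prox c"]
      norm_triangle_ineq[of "c - prox c" "x - c"] by (simp add: algebra_simps)
  also have "\<dots> \<le> norm (c - prox c) + (1 + lipc) * norm (x - c)"
    using prox_lipschitz[of x c] by (simp add: algebra_simps)
  finally have "(norm (x - prox x))\<^sup>2 \<le> (norm (c - prox c) + (1 + lipc) * norm (x - c))\<^sup>2"
    by (intro power_mono) auto
  also have "\<dots> \<le> 2 * (norm (c - prox c))\<^sup>2 + 2 * ((1 + lipc) * norm (x - c))\<^sup>2"
    using sum_squares_bound[of "norm (c - prox c)" "(1 + lipc) * norm (x - c)"]
    by (simp add: power2_sum)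
  finally show ?thesis by (simp add: power_mult_distrib)
qed

lemma abs_env_le:
  "\<bar>env x\<bar> \<le> \<bar>env c\<bar> + \<rho> * (norm (c - prox c))\<^sup>2 + \<rho> * (2 + lipc) * (norm (x - c))\<^sup>2"
proof -
  have "\<bar>(c - prox c) \<bullet> (x - c)\<bar> \<le> norm (c - prox c) * norm (x - c)"
    by (rule Cauchy_Schwarz_ineq2)
  also have "\<dots> \<le> (norm (c - prox c))\<^sup>2 + (norm (x - c))\<^sup>2"
    using sum_squares_bound[of "norm (c - prox c)" "norm (x - c)"]
      mult_nonneg_nonneg[of "norm (c - prox c)" "norm (x - c)"]
    by (simp del: mult_nonneg_nonneg zero_le_mult_iff)
  finally have "\<rho> * \<bar>(c - prox c) \<bullet> (x - c)\<bar> \<le> \<rho> * ((norm (c - prox c))\<^sup>2 + (norm (x - c))\<^sup>2)"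
    using rho_pos by (intro mult_left_mono) auto
  then have "\<bar>\<rho> * ((c - prox c) \<bullet> (x - c))\<bar> \<le> \<rho> * ((norm (c - prox c))\<^sup>2 + (norm (x - c))\<^sup>2)"
    using rho_pos by (simp add: abs_mult)
  then show ?thesis
    using env_quadratic_approx[of x c] by (simp add: algebra_simps)
qed

text \<open>\<open>prox x\<close> is a candidate in the problem defining \<open>env z\<close>, while
  \<open>env x\<close> is the objective of \<open>x\<close> at exactly this point.\<close>

lemma env_descent:
  "env z \<le> env x - \<rho> / 2 * (norm (x - prox x))\<^sup>2 + \<rho> / 2 * (norm (prox x - z))\<^sup>2"
  using env_le[OF phi_prox, of z x] env_eq[of x] by (simp add: norm_minus_commute)

lemma INF_le_env: "(INF y. \<phi> y) \<le> ereal (env x)"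
proof -
  have "(INF y. \<phi> y) \<le> \<phi> (prox x)" by (rule INF_lower) simp
  also have "\<dots> \<le> ereal (env x)"
    using rho_pos by (subst phi_prox) (simp add: env_eq)
  finally show ?thesis .
qed

end

section \<open>One-sided stochastic models\<close>

lemma locally_lipschitz_imp_continuous_on:
  assumes "locally_lipschitz f"
  shows "continuous_on UNIV f"
proof (intro continuous_at_imp_continuous_on ballI)
  fix x
  obtain e K where e: "e > 0" and K: "\<And>y z. y \<in> ball x e \<Longrightarrow> z \<in> ball x e \<Longrightarrow> \<bar>f y - f z\<bar> \<le> K * dist y z"
    using assms unfolding locally_lipschitz_def by meson
  have "(\<bar>K\<bar>)-lipschitz_on (ball x e) f"
  proof (rule lipschitz_onI)
    fix y z assume "y \<in> ball x e" "z \<in> ball x e"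
    then have "\<bar>f y - f z\<bar> \<le> K * dist y z" by (rule K)
    also have "\<dots> \<le> \<bar>K\<bar> * dist y z" by (intro mult_right_mono) auto
    finally show "dist (f y) (f z) \<le> \<bar>K\<bar> * dist y z" by (simp add: dist_real_def)
  qed simp
  then have "continuous_on (ball x e) f" by (rule lipschitz_on_continuous_on)
  then show "isCont f x" using e by (simp add: continuous_on_eq_continuous_at)
qed

text \<open>Cut the segment into \<open>n + 1\<close> equal pieces. The linear terms add up to
  \<open>C * d\<close>, whereas the quadratic ones add up to \<open>D * d^2 / (n + 1)\<close> and
  vanish in the limit.\<close>

lemma lipschitz_on_convex_from_quadratic_bound:
  fixes f :: "'a::real_normed_vector \<Rightarrow> real"
  assumes "convex U"
    and bound: "\<And>x y. x \<in> U \<Longrightarrow> y \<in> U \<Longrightarrow> f x - f y \<le> C * norm (x - y) + D * (norm (x - y))\<^sup>2"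
    and "x \<in> U" "y \<in> U"
  shows "f x - f y \<le> C * norm (x - y)"
proof -
  define d where "d = norm (x - y)"
  have *: "f x - f y \<le> C * d + D * d\<^sup>2 * (1 / real (Suc n))" for n
  proof -
    define h where "h = 1 / real (Suc n)"
    define p where "p i = x + (real i * h) *\<^sub>R (y - x)" for i
    have p_in: "p i \<in> U" if "i \<le> Suc n" for i
    proof -
      have "p i = (1 - real i * h) *\<^sub>R x + (real i * h) *\<^sub>R y"
        by (simp add: p_def algebra_simps)
      moreover have "0 \<le> real i * h" "real i * h \<le> 1" using that by (auto simp: h_def)
      ultimately show ?thesis using assms(1,3,4) by (simp add: convexD_alt)
    qed
    have "p i - p (Suc i) = h *\<^sub>R (x - y)" for i
      by (simp add: p_def algebra_simps)
    then have step: "norm (p i - p (Suc i)) = h * d" for i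
      by (simp add: d_def h_def)
    have "f x - f y = (\<Sum>i<Suc n. f (p i) - f (p (Suc i)))"
      using sum_lessThan_telescope'[of "\<lambda>i. f (p i)" "Suc n"] by (simp add: p_def h_def)
    also have "\<dots> \<le> (\<Sum>i<Suc n. C * (h * d) + D * (h * d)\<^sup>2)"
    proof (rule sum_mono)
      fix i assume "i \<in> {..<Suc n}"
      then show "f (p i) - f (p (Suc i)) \<le> C * (h * d) + D * (h * d)\<^sup>2"
        using bound[OF p_in[of i] p_in[of "Suc i"]] by (simp add: step)
    qed
    also have "\<dots> = C * d + D * d\<^sup>2 * h"
      unfolding h_def by (simp add: field_simps power2_eq_square del: of_nat_Suc)
    finally show ?thesis by (simp add: h_def)
  qed
  have "(\<lambda>n. C * d + D * d\<^sup>2 * (1 / real (Suc n))) \<longlonglongrightarrow> C * d + D * d\<^sup>2 * 0"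
    by (intro tendsto_intros LIMSEQ_Suc[OF lim_1_over_n])
  then have "f x - f y \<le> C * d + D * d\<^sup>2 * 0"
    by (rule LIMSEQ_le_const) (use * in auto)
  then show ?thesis by (simp add: d_def)
qed

locale stochastic_model = prob_space M
  for M :: "'w measure" +
  fixes r :: "'a::euclidean_space \<Rightarrow> ereal" and f :: "'a \<Rightarrow> real" and U :: "'a set"
    and F :: "'a \<Rightarrow> 'a \<Rightarrow> 'w \<Rightarrow> real" and L :: "'w \<Rightarrow> real" and \<tau> \<eta> Lc \<rho> :: real
  assumes r_closed: "closed_fun r"
    and r_not_MInf: "\<And>x. r x \<noteq> -\<infinity>" and r_proper: "\<exists>x. r x < \<infinity>"
    and f_lip: "locally_lipschitz f"
    and tau: "\<tau> \<ge> 0"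
    and U_convex: "convex U" and dom_U: "dom_fun r \<subseteq> U"
    and F_integrable: "\<And>x y. x \<in> U \<Longrightarrow> y \<in> U \<Longrightarrow> integrable M (F x y)"
    and F_diag: "\<And>x. x \<in> U \<Longrightarrow> (\<integral>\<xi>. F x x \<xi> \<partial>M) = f x"
    and F_bound: "\<And>x y. x \<in> U \<Longrightarrow> y \<in> U \<Longrightarrow> (\<integral>\<xi>. F x y \<xi> - f y \<partial>M) \<le> \<tau> / 2 * (norm (y - x))\<^sup>2"
    and F_weakly_convex: "\<And>x. x \<in> U \<Longrightarrow> AE \<xi> in M. weakly_convex \<eta> (\<lambda>y. ereal (F x y \<xi>) + r y)"
    and L_meas[measurable]: "L \<in> borel_measurable M"
    and L_sq: "integrable M (\<lambda>\<xi>. (L \<xi>)\<^sup>2)" "sqrt (\<integral>\<xi>. (L \<xi>)\<^sup>2 \<partial>M) \<le> Lc"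
    and F_lip: "AE \<xi> in M. \<forall>x\<in>U. \<forall>y\<in>U. F x x \<xi> - F x y \<xi> \<le> L \<xi> * norm (x - y)"
    and rho: "\<rho> > max (\<tau> + \<eta>) 0"
begin

section \<open>Properties of \<open>f\<close> and \<open>\<phi>\<close> inherited from the
  models\<close>

lemma r_real:
  assumes "r x < \<infinity>"
  obtains a where "r x = ereal a" "x \<in> U"
  using assms r_not_MInf[of x] dom_U by (cases "r x") (auto simp: dom_fun_def subset_eq)

lemma F_bound': "x \<in> U \<Longrightarrow> y \<in> U \<Longrightarrow> (\<integral>\<xi>. F x y \<xi> \<partial>M) \<le> f y + \<tau> / 2 * (norm (y - x))\<^sup>2"
  using F_bound[of x y] F_integrable[of x y] by (simp add: prob_space)

lemma L_integrable: "integrable M L"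
  by (rule square_integrable_imp_integrable[OF L_meas L_sq(1)])

lemma Lc_nonneg: "0 \<le> Lc"
  using L_sq(2) by (rule order_trans[rotated]) simp

lemma L_sq_le: "(\<integral>\<xi>. (L \<xi>)\<^sup>2 \<partial>M) \<le> Lc\<^sup>2"
  using L_sq(2) by (rule sqrt_le_D)

text \<open>Nonnegativity of the variance bounds the squared mean by the second moment.\<close>

lemma L_mean_le: "(\<integral>\<xi>. L \<xi> \<partial>M) \<le> Lc"
proof (rule power2_le_imp_le)
  have "(\<integral>\<xi>. L \<xi> \<partial>M)\<^sup>2 \<le> (\<integral>\<xi>. (L \<xi>)\<^sup>2 \<partial>M)"
    using variance_eq[OF L_integrable L_sq(1)] variance_positive[of L] by simp
  also have "\<dots> \<le> Lc\<^sup>2" by (rule L_sq_le)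
  finally show "(\<integral>\<xi>. L \<xi> \<partial>M)\<^sup>2 \<le> Lc\<^sup>2" .
qed (rule Lc_nonneg)

text \<open>The model centred at \<open>x\<close> has mean \<open>f x\<close> at \<open>x\<close>
  and mean at most \<open>f y + \<tau>/2 |y - x|^2\<close> at \<open>y\<close>. The Lipschitz bound
  on the model thus passes to \<open>f\<close> up to a quadratic term, which subdividing segments of
  the convex set \<open>U\<close> removes.\<close>

lemma f_lipschitz_on_U:
  assumes "x \<in> U" "y \<in> U"
  shows "f x - f y \<le> Lc * norm (x - y)"
proof (rule lipschitz_on_convex_from_quadratic_bound[OF U_convex _ assms])
  fix x y assume xy: "x \<in> U" "y \<in> U"
  have "f x - (\<integral>\<xi>. F x y \<xi> \<partial>M) = (\<integral>\<xi>. F x x \<xi> - F x y \<xi> \<partial>M)"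
    using xy by (simp add: F_integrable F_diag)
  also have "\<dots> \<le> (\<integral>\<xi>. L \<xi> * norm (x - y) \<partial>M)"
    using F_lip xy by (intro integral_mono_AE) (auto simp: F_integrable L_integrable)
  also have "\<dots> = (\<integral>\<xi>. L \<xi> \<partial>M) * norm (x - y)" by simp
  also have "\<dots> \<le> Lc * norm (x - y)" by (intro mult_right_mono L_mean_le) simp
  finally show "f x - f y \<le> Lc * norm (x - y) + \<tau> / 2 * (norm (x - y))\<^sup>2"
    using F_bound'[OF xy] by (simp add: norm_minus_commute)
qed

abbreviation \<phi> :: "'a \<Rightarrow> ereal" where
  "\<phi> x \<equiv> ereal (f x) + r x"

lemma phi_weakly_convex: "weakly_convex (\<tau> + \<eta>) \<phi>"
proof (rule weakly_convexI)
  fix x show "\<phi> x \<noteq> -\<infinity>" using r_not_MInf by simp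
next
  fix x y :: 'a and a b u :: real
  assume xy: "\<phi> x = ereal a" "\<phi> y = ereal b" and u: "0 < u" "u < 1"
  \<comment> \<open>Centring the model at the combination \<open>w\<close> makes its mean exact
    there. The errors at \<open>x\<close> and \<open>y\<close> combine through
    \<open>(1 - u) * u^2 + u * (1 - u)^2 = u * (1 - u)\<close>.\<close>
  define w where "w = (1 - u) *\<^sub>R x + u *\<^sub>R y"
  define N where "N = (norm (x - y))\<^sup>2"
  from xy have "r x < \<infinity>" "r y < \<infinity>" by auto
  then obtain rx ry where rx: "r x = ereal rx" "x \<in> U" and ry: "r y = ereal ry" "y \<in> U"
    by (metis r_real)
  have w: "w \<in> U" using U_convex rx(2) ry(2) u by (simp add: w_def convexD_alt)
  have AEw: "AE \<xi> in M. ereal (F w w \<xi>) + r w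
      \<le> ereal ((1 - u) * (F w x \<xi> + rx) + u * (F w y \<xi> + ry) + \<eta> / 2 * (u * (1 - u) * N))"
    using F_weakly_convex[OF w]
  proof eventually_elim
    case (elim \<xi>)
    then show ?case
      using weakly_convexD[OF elim, of x "F w x \<xi> + rx" y "F w y \<xi> + ry" u] u
      by (simp add: rx ry w_def N_def)
  qed
  \<comment> \<open>\<open>r w\<close> does not depend on the sample, so one sample with a finite
    upper bound suffices.\<close>
  then have "r w < \<infinity>"
    by (rule prob_space.AE_const[OF prob_space_axioms, THEN iffD1, OF AE_mp]) auto
  then obtain rw where rw: "r w = ereal rw" by (rule r_real)
  have "f w + rw = (\<integral>\<xi>. F w w \<xi> + rw \<partial>M)"
    using w by (simp add: F_diag F_integrable prob_space)
  also have "\<dots> \<le> (\<integral>\<xi>. (1 - u) * (F w x \<xi> + rx) + u * (F w y \<xi> + ry) + \<eta> / 2 * (u * (1 - u) * N) \<partial>M)"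
    using AEw w rx ry by (intro integral_mono_AE) (auto simp: rw F_integrable)
  also have "\<dots> = (1 - u) * ((\<integral>\<xi>. F w x \<xi> \<partial>M) + rx) + u * ((\<integral>\<xi>. F w y \<xi> \<partial>M) + ry) + \<eta> / 2 * (u * (1 - u) * N)"
    using w rx ry by (simp add: F_integrable prob_space)
  also have "\<dots> \<le> (1 - u) * ((f x + \<tau> / 2 * (norm (x - w))\<^sup>2) + rx)
      + u * ((f y + \<tau> / 2 * (norm (y - w))\<^sup>2) + ry) + \<eta> / 2 * (u * (1 - u) * N)"
    using w rx ry u by (intro order_refl add_mono mult_left_mono F_bound') auto
  also have "x - w = u *\<^sub>R (x - y)" by (simp add: w_def algebra_simps)
  also have "y - w = (u - 1) *\<^sub>R (x - y)" by (simp add: w_def algebra_simps)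
  also have "(1 - u) * ((f x + \<tau> / 2 * (norm (u *\<^sub>R (x - y)))\<^sup>2) + rx)
      + u * ((f y + \<tau> / 2 * (norm ((u - 1) *\<^sub>R (x - y)))\<^sup>2) + ry) + \<eta> / 2 * (u * (1 - u) * N)
      = (1 - u) * a + u * b + (\<tau> + \<eta>) / 2 * (u * (1 - u) * N)"
  proof -
    have ab: "a = f x + rx" "b = f y + ry" using xy rx ry by auto
    have n: "(norm (c *\<^sub>R (x - y)))\<^sup>2 = c\<^sup>2 * N" for c :: real
      by (simp add: N_def power_mult_distrib)
    show ?thesis
      unfolding n ab by (simp add: field_simps power2_eq_square)
  qed
  finally have "f w + rw \<le> (1 - u) * a + u * b + (\<tau> + \<eta>) / 2 * (u * (1 - u) * N)" .
  then show "\<phi> ((1 - u) *\<^sub>R x + u *\<^sub>R y)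
      \<le> ereal ((1 - u) * a + u * b + (\<tau> + \<eta>) / 2 * (u * (1 - u) * (norm (x - y))\<^sup>2))"
    using rw by (simp add: w_def N_def)
qed

sublocale proximal \<phi> "\<tau> + \<eta>" \<rho>
proof
  show "closed_fun \<phi>"
    using closed_fun_add_continuous[OF r_closed locally_lipschitz_imp_continuous_on[OF f_lip]]
    by (simp add: add.commute)
  show "\<exists>x. \<phi> x < \<infinity>" using r_proper by auto
qed (use phi_weakly_convex r_not_MInf rho in auto)

section \<open>A single step of the method for a fixed centre\<close>

definition is_step :: "real \<Rightarrow> 'a \<Rightarrow> 'w \<Rightarrow> 'a \<Rightarrow> bool" where
  "is_step b x \<xi> z \<longleftrightarrow> (\<forall>y. r z + ereal (F x z \<xi>) + ereal (b / 2 * (norm (z - x))\<^sup>2)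
      \<le> r y + ereal (F x y \<xi>) + ereal (b / 2 * (norm (y - x))\<^sup>2))"

lemma is_step_dom:
  assumes "is_step b x \<xi> z"
  shows "r z < \<infinity>"
proof -
  obtain q where "r q < \<infinity>" using r_proper by blast
  then obtain c where "r q = ereal c" by (rule r_real)
  with assms[unfolded is_step_def, rule_format, of q] show ?thesis by (cases "r z") auto
qed

lemma is_step_growth:
  assumes wc: "weakly_convex \<eta> (\<lambda>y. ereal (F x y \<xi>) + r y)" and z: "is_step b x \<xi> z"
    and rz: "r z = ereal rz" and ry: "r y = ereal ry"
  shows "F x z \<xi> + rz + b / 2 * (norm (z - x))\<^sup>2 + (b - \<eta>) / 2 * (norm (y - z))\<^sup>2
    \<le> F x y \<xi> + ry + b / 2 * (norm (y - x))\<^sup>2"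
proof (rule quadratic_growth_at_minimizer)
  show "weakly_convex (-(b - \<eta>)) (\<lambda>y. ereal (F x y \<xi>) + r y + ereal (b / 2 * (norm (y - x))\<^sup>2))"
    using weakly_convex_add_norm_sq[OF wc, of b x] r_not_MInf by simp
qed (use z rz ry in \<open>simp_all add: is_step_def add.commute\<close>)

lemma is_step_unique:
  assumes "weakly_convex \<eta> (\<lambda>y. ereal (F x y \<xi>) + r y)" "is_step b x \<xi> z" "is_step b x \<xi> z'" "\<eta> < b"
  shows "z = z'"
proof -
  obtain a a' where a: "r z = ereal a" "r z' = ereal a'"
    by (metis assms(2,3) is_step_dom r_real)
  from is_step_growth[OF assms(1,2) a] is_step_growth[OF assms(1,3) a(2,1)]
  have "(b - \<eta>) / 2 * (norm (z - z'))\<^sup>2 \<le> 0"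
    unfolding norm_minus_commute[of z' z] by linarith
  then show ?thesis using assms(4) by (simp add: mult_le_0_iff)
qed

text \<open>Growth of the step objective at \<open>y\<close> and minimality of \<open>prox x\<close>
  tested at \<open>z\<close> are added, which cancels the values of \<open>r\<close>. The Lipschitz
  bounds on the model and on \<open>f\<close> leave a quadratic in the step length
  \<open>s\<close>.\<close>

lemma is_step_prox_bound:
  assumes x: "x \<in> U" and wc: "weakly_convex \<eta> (\<lambda>y. ereal (F x y \<xi>) + r y)"
    and lip: "\<forall>x\<in>U. \<forall>y\<in>U. F x x \<xi> - F x y \<xi> \<le> L \<xi> * norm (x - y)"
    and z: "is_step b x \<xi> z" and b: "\<rho> < b"
  defines "y \<equiv> prox x"
  shows "(b - \<eta>) / 2 * (norm (y - z))\<^sup>2 \<le> F x y \<xi> - F x x \<xi> - (f y - f x)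
    + (b - \<rho>) / 2 * (norm (x - y))\<^sup>2 + (L \<xi> + Lc)\<^sup>2 / (2 * (b - \<rho>))"
proof -
  obtain rz where rz: "r z = ereal rz" "z \<in> U" using is_step_dom[OF z] by (rule r_real)
  have "\<phi> y < \<infinity>" unfolding y_def by (subst phi_prox) simp
  then have "r y < \<infinity>" by auto
  then obtain ry where ry: "r y = ereal ry" "y \<in> U" by (rule r_real)
  define s where "s = norm (x - z)"
  have "F x x \<xi> - F x z \<xi> \<le> L \<xi> * s" using lip x rz by (auto simp: s_def)
  moreover have "f z - f x \<le> Lc * s"
    using f_lipschitz_on_U[OF rz(2) x] by (simp add: s_def norm_minus_commute)
  moreover have "f y + ry + \<rho> / 2 * (norm (x - y))\<^sup>2 \<le> f z + rz + \<rho> / 2 * s\<^sup>2"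
    using env_le[of z "f z + rz" x] env_eq[of x] rz ry
    by (simp add: y_def[symmetric] s_def norm_minus_commute)
  moreover have "F x z \<xi> + rz + b / 2 * s\<^sup>2 + (b - \<eta>) / 2 * (norm (y - z))\<^sup>2
      \<le> F x y \<xi> + ry + b / 2 * (norm (x - y))\<^sup>2"
    using is_step_growth[OF wc z rz(1) ry(1)] by (simp add: s_def norm_minus_commute)
  \<comment> \<open>Completing the square gives the maximum over \<open>s\<close> of this concave
    quadratic.\<close>
  moreover have "(L \<xi> + Lc) * s - (b - \<rho>) / 2 * s\<^sup>2 \<le> (L \<xi> + Lc)\<^sup>2 / (2 * (b - \<rho>))"
  proof -
    have "(L \<xi> + Lc)\<^sup>2 / (2 * (b - \<rho>)) - ((L \<xi> + Lc) * s - (b - \<rho>) / 2 * s\<^sup>2)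
        = (L \<xi> + Lc - (b - \<rho>) * s)\<^sup>2 / (2 * (b - \<rho>))"
      using b by (simp add: field_simps power2_eq_square)
    also have "\<dots> \<ge> 0" using b by simp
    finally show ?thesis by simp
  qed
  moreover have "(L \<xi> + Lc) * s = L \<xi> * s + Lc * s" by (simp add: algebra_simps)
  moreover have "(b - \<rho>) / 2 * s\<^sup>2 = b / 2 * s\<^sup>2 - \<rho> / 2 * s\<^sup>2"
    "(b - \<rho>) / 2 * (norm (x - y))\<^sup>2 = b / 2 * (norm (x - y))\<^sup>2 - \<rho> / 2 * (norm (x - y))\<^sup>2"
    by (simp_all add: field_simps)
  ultimately show ?thesis by linarith
qed

text \<open>The mean of \<open>F x x\<close> cancels \<open>f x\<close>, the overestimate of
  \<open>f y\<close> adds \<open>\<tau>\<close> to the coefficient \<open>b - \<rho>\<close>, and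
  \<open>(L + Lc)^2\<close> has mean at most \<open>4 * Lc^2\<close>.\<close>

lemma is_step_prox_bound_integral:
  assumes x: "x \<in> U" and b: "\<rho> < b"
  defines "y \<equiv> prox x"
  defines "h \<equiv> \<lambda>\<xi>. F x y \<xi> - F x x \<xi> - (f y - f x)
    + (b - \<rho>) / 2 * (norm (x - y))\<^sup>2 + (L \<xi> + Lc)\<^sup>2 / (2 * (b - \<rho>))"
  shows "integrable M h"
    and "(\<integral>\<xi>. h \<xi> \<partial>M) \<le> (b + \<tau> - \<rho>) / 2 * (norm (x - y))\<^sup>2 + 2 * Lc\<^sup>2 / (b - \<rho>)"
proof -
  have "\<phi> y < \<infinity>" unfolding y_def by (subst phi_prox) simp
  then have "r y < \<infinity>" by auto
  then obtain ry where y: "y \<in> U" by (rule r_real)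
  note [simp] = F_integrable[OF x x] F_integrable[OF x y] L_integrable L_sq(1)
  have L2: "integrable M (\<lambda>\<xi>. (L \<xi> + Lc)\<^sup>2)" by (simp add: power2_sum)
  have "(\<integral>\<xi>. (L \<xi> + Lc)\<^sup>2 \<partial>M) = (\<integral>\<xi>. (L \<xi>)\<^sup>2 \<partial>M) + Lc\<^sup>2 + 2 * (\<integral>\<xi>. L \<xi> \<partial>M) * Lc"
    by (simp add: power2_sum prob_space)
  also have "\<dots> \<le> Lc\<^sup>2 + Lc\<^sup>2 + 2 * Lc * Lc"
    using L_sq_le L_mean_le Lc_nonneg by (intro add_mono mult_right_mono) auto
  also have "\<dots> = 4 * Lc\<^sup>2" by (simp add: power2_eq_square)
  finally have L4: "(\<integral>\<xi>. (L \<xi> + Lc)\<^sup>2 \<partial>M) / (2 * (b - \<rho>)) \<le> 4 * Lc\<^sup>2 / (2 * (b - \<rho>))"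
    using b by (intro divide_right_mono) auto
  show "integrable M h" unfolding h_def using L2 by simp
  have "(\<integral>\<xi>. h \<xi> \<partial>M) = (\<integral>\<xi>. F x y \<xi> \<partial>M) - f x - (f y - f x)
      + (b - \<rho>) / 2 * (norm (x - y))\<^sup>2 + (\<integral>\<xi>. (L \<xi> + Lc)\<^sup>2 \<partial>M) / (2 * (b - \<rho>))"
    unfolding h_def using L2 F_diag[OF x] by (simp add: prob_space)
  also have "\<dots> \<le> \<tau> / 2 * (norm (x - y))\<^sup>2 + (b - \<rho>) / 2 * (norm (x - y))\<^sup>2 + 4 * Lc\<^sup>2 / (2 * (b - \<rho>))"
    using F_bound'[OF x y] L4 by (simp add: norm_minus_commute)
  also have "\<dots> = (b + \<tau> - \<rho>) / 2 * (norm (x - y))\<^sup>2 + 2 * Lc\<^sup>2 / (b - \<rho>)"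
    using b by (simp add: field_simps)
  finally show "(\<integral>\<xi>. h \<xi> \<partial>M) \<le> (b + \<tau> - \<rho>) / 2 * (norm (x - y))\<^sup>2 + 2 * Lc\<^sup>2 / (b - \<rho>)" .
qed

end

section \<open>Splitting a sequence of samples at a coordinate\<close>

context sequence_space
begin

text \<open>In \<open>comb_seq t a (case_nat s c)\<close> the entries before \<open>t\<close> come
  from \<open>a\<close>, entry \<open>t\<close> is \<open>s\<close>, and the later ones come from
  \<open>c\<close>. Drawing the three independently reproduces the law \<open>S\<close>, so the
  integral becomes an iterated one over past, sample and future.\<close>

lemma nn_integral_split_at:
  assumes [measurable]: "g \<in> borel_measurable S"
  shows "(\<integral>\<^sup>+\<omega>. g \<omega> \<partial>S)
    = (\<integral>\<^sup>+a. \<integral>\<^sup>+s. \<integral>\<^sup>+c. g (comb_seq t a (case_nat s c)) \<partial>S \<partial>M \<partial>S)"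
proof -
  have iter: "(\<integral>\<^sup>+\<omega>. h \<omega> \<partial>S) = (\<integral>\<^sup>+s. \<integral>\<^sup>+c. h (case_nat s c) \<partial>S \<partial>M)"
    if [measurable]: "h \<in> borel_measurable S" for h
    by (subst PiM_iter[symmetric]) (simp add: nn_integral_distr P.nn_integral_fst[symmetric] split_beta')
  have "(\<integral>\<^sup>+\<omega>. g \<omega> \<partial>S) = (\<integral>\<^sup>+a. \<integral>\<^sup>+b. g (comb_seq t a b) \<partial>S \<partial>S)"
    by (subst PiM_comb_seq[symmetric, of t])
      (simp add: nn_integral_distr P.nn_integral_fst[symmetric] split_beta')
  also have "\<dots> = (\<integral>\<^sup>+a. \<integral>\<^sup>+s. \<integral>\<^sup>+c. g (comb_seq t a (case_nat s c)) \<partial>S \<partial>M \<partial>S)"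
    by (intro nn_integral_cong iter) measurable
  finally show ?thesis .
qed

lemma pair_sigma_finite_S: "pair_sigma_finite S S" "pair_sigma_finite M S"
  by (intro pair_sigma_finite.intro P.sigma_finite_measure_axioms M.sigma_finite_measure_axioms)+

lemma AE_split_at:
  assumes "AE \<omega> in S. P \<omega>"
  shows "AE a in S. AE s in M. AE c in S. P (comb_seq t a (case_nat s c))"
proof -
  have "AE p in S \<Otimes>\<^sub>M S. P (case p of (a, b) \<Rightarrow> comb_seq t a b)"
    by (rule AE_distrD[OF measurable_comb_seq]) (unfold PiM_comb_seq, rule assms)
  from pair_sigma_finite.AE_pair[OF pair_sigma_finite_S(1) this]
  have "AE a in S. AE b in S. P (comb_seq t a b)" by simp
  then show ?thesis
  proof eventually_elim
    case (elim a)
    have "AE p in M \<Otimes>\<^sub>M S. P (comb_seq t a (case p of (s, c) \<Rightarrow> case_nat s c))"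
    proof (rule AE_distrD[where P = "\<lambda>b. P (comb_seq t a b)"])
      show "AE b in distr (M \<Otimes>\<^sub>M S) S (\<lambda>(s, c). case_nat s c). P (comb_seq t a b)"
        unfolding PiM_iter by (rule elim)
    qed measurable
    from pair_sigma_finite.AE_pair[OF pair_sigma_finite_S(2) this]
    show ?case by simp
  qed
qed

lemma AE_split_atI:
  assumes [measurable]: "Measurable.pred S P"
    and "AE a in S. AE s in M. AE c in S. P (comb_seq t a (case_nat s c))"
  shows "AE \<omega> in S. P \<omega>"
proof -
  let ?g = "\<lambda>\<omega>. indicator {\<omega> \<in> space S. \<not> P \<omega>} \<omega> :: ennreal"
  have "(\<integral>\<^sup>+\<omega>. ?g \<omega> \<partial>S) = (\<integral>\<^sup>+a. \<integral>\<^sup>+s. \<integral>\<^sup>+c. ?g (comb_seq t a (case_nat s c)) \<partial>S \<partial>M \<partial>S)"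
    by (intro nn_integral_split_at) measurable
  also have "\<dots> = (\<integral>\<^sup>+a. 0 \<partial>S)"
  proof (rule nn_integral_cong_AE, use assms(2) in eventually_elim)
    case (elim a)
    have "(\<integral>\<^sup>+s. \<integral>\<^sup>+c. ?g (comb_seq t a (case_nat s c)) \<partial>S \<partial>M) = (\<integral>\<^sup>+s. 0 \<partial>M)"
    proof (rule nn_integral_cong_AE, use elim in eventually_elim)
      case (elim s)
      have "(\<integral>\<^sup>+c. ?g (comb_seq t a (case_nat s c)) \<partial>S) = (\<integral>\<^sup>+c. 0 \<partial>S)"
        by (rule nn_integral_cong_AE, use elim in eventually_elim) (simp add: indicator_def)
      then show ?case by simp
    qed
    then show ?case by simp
  qed
  finally have "emeasure S {\<omega> \<in> space S. \<not> P \<omega>} = 0" by simp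
  then show ?thesis by (subst AE_iff_measurable[OF _ refl]) auto
qed

text \<open>With the future \<open>c\<close> outermost, a single future can be fixed that is good
  for almost every past and sample.\<close>

lemma AE_split_at_swap:
  assumes "AE \<omega> in S. P \<omega>"
  shows "AE c in S. AE a in S. AE s in M. P (comb_seq t a (case_nat s c))"
proof -
  \<comment> \<open>\<open>P\<close> is an arbitrary predicate, so the exchange of integrals is
    carried out for a measurable null set covering its failures.\<close>
  obtain N where N: "{\<omega> \<in> space S. \<not> P \<omega>} \<subseteq> N" "emeasure S N = 0" "N \<in> sets S"
    using assms by (rule AE_E)
  note [measurable] = N(3)
  let ?h = "\<lambda>a s c. indicator N (comb_seq t a (case_nat s c)) :: ennreal"
  interpret SS: pair_sigma_finite S S by (rule pair_sigma_finite_S)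
  interpret MS: pair_sigma_finite M S by (rule pair_sigma_finite_S)
  have "(\<integral>\<^sup>+c. \<integral>\<^sup>+a. \<integral>\<^sup>+s. ?h a s c \<partial>M \<partial>S \<partial>S) = (\<integral>\<^sup>+a. \<integral>\<^sup>+c. \<integral>\<^sup>+s. ?h a s c \<partial>M \<partial>S \<partial>S)"
    by (rule SS.Fubini') measurable
  also have "\<dots> = (\<integral>\<^sup>+a. \<integral>\<^sup>+s. \<integral>\<^sup>+c. ?h a s c \<partial>S \<partial>M \<partial>S)"
    by (intro nn_integral_cong MS.Fubini') measurable
  also have "\<dots> = (\<integral>\<^sup>+\<omega>. indicator N \<omega> \<partial>S)"
    by (rule nn_integral_split_at[symmetric]) measurable
  also have "\<dots> = 0" using N by simp
  finally have "AE c in S. (\<integral>\<^sup>+a. \<integral>\<^sup>+s. ?h a s c \<partial>M \<partial>S) = 0"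
    by (subst (asm) nn_integral_0_iff_AE) measurable
  moreover have "AE c in S. c \<in> space S" by simp
  ultimately show ?thesis
  proof eventually_elim
    case (elim c)
    note [measurable] = elim(2)
    from elim(1) have "AE a in S. (\<integral>\<^sup>+s. ?h a s c \<partial>M) = 0"
      by (subst (asm) nn_integral_0_iff_AE) measurable
    moreover have "AE a in S. a \<in> space S" by simp
    ultimately show ?case
    proof eventually_elim
      case (elim a)
      note [measurable] = elim(2)
      from elim(1) have "AE s in M. ?h a s c = 0"
        by (subst (asm) nn_integral_0_iff_AE) measurable
      moreover have "AE s in M. s \<in> space M" by simp
      ultimately show ?case
      proof eventually_elim
        case (elim s)
        have "(\<lambda>s. comb_seq t a (case_nat s c)) \<in> measurable M S" by measurable
        from measurable_space[OF this elim(2)] elim(1) N(1) show ?case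
          by (auto simp: indicator_def split: if_splits)
      qed
    qed
  qed
qed

end

section \<open>The stochastic proximal method\<close>

lemma comb_seq_self: "comb_seq t a (case_nat s c) t = s"
  by (simp add: comb_seq_def)

locale stochastic_prox_method = stochastic_model M r f U F L \<tau> \<eta> Lc \<rho>
  for M :: "'w measure" and r :: "'a::euclidean_space \<Rightarrow> ereal" and f :: "'a \<Rightarrow> real" and U :: "'a set"
    and F :: "'a \<Rightarrow> 'a \<Rightarrow> 'w \<Rightarrow> real" and L :: "'w \<Rightarrow> real" and \<tau> \<eta> Lc \<rho> :: real +
  fixes T :: nat and \<beta> :: "nat \<Rightarrow> real" and x0 :: 'a and X :: "nat \<Rightarrow> (nat \<Rightarrow> 'w) \<Rightarrow> 'a"
  assumes beta: "\<And>t. t \<le> T \<Longrightarrow> \<rho> < \<beta> t"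
    and x0: "x0 \<in> U"
    and X0: "\<And>\<omega>. \<omega> \<in> space (\<Pi>\<^sub>M i\<in>UNIV. M) \<Longrightarrow> X 0 \<omega> = x0"
    and X_meas: "\<And>t. t \<le> Suc T \<Longrightarrow> X t \<in> borel_measurable (\<Pi>\<^sub>M i\<in>UNIV. M)"
    and X_step: "\<And>t. t \<le> T \<Longrightarrow> AE \<omega> in (\<Pi>\<^sub>M i\<in>UNIV. M). is_step (\<beta> t) (X t \<omega>) (\<omega> t) (X (Suc t) \<omega>)"
begin

sublocale seq: sequence_space M ..

abbreviation S :: "(nat \<Rightarrow> 'w) measure" where "S \<equiv> \<Pi>\<^sub>M i\<in>UNIV. M"

lemma eta_less_beta: "t \<le> T \<Longrightarrow> \<eta> < \<beta> t"
  using beta[of t] rho tau by simp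

lemma X_in_U:
  assumes "t \<le> Suc T"
  shows "AE \<omega> in S. X t \<omega> \<in> U"
proof (cases t)
  case 0
  show ?thesis unfolding 0 by (rule AE_I2) (simp add: X0 x0)
next
  case (Suc s)
  then have "AE \<omega> in S. is_step (\<beta> s) (X s \<omega>) (\<omega> s) (X t \<omega>)" using X_step[of s] assms by simp
  then show ?thesis by eventually_elim (metis is_step_dom r_real)
qed

text \<open>The iterates are only assumed to be measurable functions of the whole sequence of samples. That
  \<open>X t\<close> is determined by the first \<open>t\<close> samples, hence independent of the next one, follows from the
  uniqueness of the minimizers.\<close>

definition adapted_version :: "nat \<Rightarrow> ((nat \<Rightarrow> 'w) \<Rightarrow> 'a) \<Rightarrow> bool" where
  "adapted_version t Y \<longleftrightarrow> Y \<in> borel_measurable S \<and> (\<forall>a b. Y (comb_seq t a b) = Y a)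
     \<and> (AE \<omega> in S. X t \<omega> = Y \<omega>)"

lemma AE_adapted_step:
  assumes t: "t \<le> T" and Y: "adapted_version t Y"
  shows "AE a in S. Y a \<in> U"
    and "AE a in S. AE s in M. weakly_convex \<eta> (\<lambda>y. ereal (F (Y a) y s) + r y)"
    and "AE \<omega> in S. X t \<omega> = Y \<omega> \<and> is_step (\<beta> t) (Y \<omega>) (\<omega> t) (X (Suc t) \<omega>)"
proof -
  have XY: "AE \<omega> in S. X t \<omega> = Y \<omega>" using Y by (simp add: adapted_version_def)
  have "AE \<omega> in S. X t \<omega> \<in> U" using t by (intro X_in_U) simp
  with XY show U: "AE a in S. Y a \<in> U" by eventually_elim simp
  then show "AE a in S. AE s in M. weakly_convex \<eta> (\<lambda>y. ereal (F (Y a) y s) + r y)"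
    by eventually_elim (rule F_weakly_convex)
  from XY X_step[OF t]
  show "AE \<omega> in S. X t \<omega> = Y \<omega> \<and> is_step (\<beta> t) (Y \<omega>) (\<omega> t) (X (Suc t) \<omega>)"
    by eventually_elim simp
qed

text \<open>The objective minimized by \<open>X (Suc t)\<close> involves the past and the sample at
  \<open>t\<close> only. As its minimizer is almost surely unique, evaluating
  \<open>X (Suc t)\<close> at one fixed future changes it on a null set only.\<close>

lemma adapted_version_exists:
  assumes "t \<le> Suc T"
  shows "\<exists>Y. adapted_version t Y"
  using assms
proof (induction t)
  case 0
  have "AE \<omega> in S. X 0 \<omega> = x0" by (rule AE_I2) (rule X0)
  then have "adapted_version 0 (\<lambda>_. x0)" by (simp add: adapted_version_def)
  then show ?case by blast
next
  case (Suc t)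
  then have t: "t \<le> T" by simp
  obtain Y where Y: "adapted_version t Y" using Suc by auto
  have Y_comb: "Y (comb_seq t a b) = Y a" for a b using Y by (simp add: adapted_version_def)
  note [measurable] = X_meas[OF Suc.prems]
  let ?Z = "X (Suc t)"
  note step = AE_adapted_step[OF t Y]
  have "AE v in S. v \<in> space S \<and>
      (AE a in S. AE s in M. is_step (\<beta> t) (Y a) s (?Z (comb_seq t a (case_nat s v))))"
    using seq.AE_split_at_swap[OF step(3), of t] by (auto simp: Y_comb comb_seq_self)
  then obtain v where v: "v \<in> space S"
    and v_step: "AE a in S. AE s in M. is_step (\<beta> t) (Y a) s (?Z (comb_seq t a (case_nat s v)))"
    using eventually_happens'[OF seq.P.ae_filter_bot] by blast
  \<comment> \<open>freezing the samples from time \<open>t + 1\<close> on at \<open>v\<close> gives a measurable version of the unique minimizer\<close>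
  note [measurable] = v
  define Y' where "Y' \<omega> = ?Z (comb_seq (Suc t) \<omega> v)" for \<omega>
  have Y'_meas[measurable]: "Y' \<in> borel_measurable S" unfolding Y'_def by measurable
  have Y'_comb: "Y' (comb_seq (Suc t) a b) = Y' a" for a b
  proof -
    have "comb_seq (Suc t) (comb_seq (Suc t) a b) v = comb_seq (Suc t) a v"
      by (auto simp: comb_seq_def)
    then show ?thesis by (simp add: Y'_def)
  qed
  have "AE \<omega> in S. ?Z \<omega> = Y' \<omega>"
  proof (rule seq.AE_split_atI[where t = t])
    have "Measurable.pred S (\<lambda>\<omega>. norm (?Z \<omega> - Y' \<omega>) = 0)" by measurable
    then show "Measurable.pred S (\<lambda>\<omega>. ?Z \<omega> = Y' \<omega>)" by simp
    show "AE a in S. AE s in M. AE c in S. ?Z (comb_seq t a (case_nat s c)) = Y' (comb_seq t a (case_nat s c))"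
      using seq.AE_split_at[OF step(3), of t] v_step step(2)
    proof eventually_elim
      case (elim a)
      then show ?case
      proof eventually_elim
        case (elim s)
        from elim(1) show ?case
        proof eventually_elim
          case elim': (elim c)
          \<comment> \<open>The first \<open>Suc t\<close> coordinates are the past \<open>a\<close>
            together with the sample \<open>s\<close>, so freezing only replaces \<open>c\<close> by
            \<open>v\<close>.\<close>
          have "comb_seq (Suc t) (comb_seq t a (case_nat s c)) v = comb_seq t a (case_nat s v)"
            by (simp add: comb_seq_Suc comb_seq_self) (auto simp: comb_seq_def fun_eq_iff)
          then show ?case
            using is_step_unique[OF elim(3) _ elim(2) eta_less_beta[OF t]] elim'
            by (simp add: Y'_def Y_comb comb_seq_self)
        qed
      qed
    qed
  qed
  then have "adapted_version (Suc t) Y'"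
    using Y'_meas Y'_comb by (simp add: adapted_version_def)
  then show ?case by blast
qed

section \<open>Expected one-step estimate and second moments\<close>

lemma prox_meas[measurable]: "prox \<in> borel_measurable borel"
  using continuous_on_prox by (rule borel_measurable_continuous_onI)

lemma env_meas[measurable]: "env \<in> borel_measurable borel"
  using continuous_on_env by (rule borel_measurable_continuous_onI)

text \<open>Fixing the past fixes the centre \<open>Y a\<close>, so the pointwise bound can be
  integrated over the fresh sample alone. Nonnegative integrals are used because integrability of
  the left-hand side is to be deduced from this very bound.\<close>

lemma nn_integral_prox_distance_le:
  assumes t: "t \<le> T"
  shows "(\<integral>\<^sup>+\<omega>. ennreal ((\<beta> t - \<eta>) / 2 * (norm (prox (X t \<omega>) - X (Suc t) \<omega>))\<^sup>2) \<partial>S)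
    \<le> (\<integral>\<^sup>+\<omega>. ennreal ((\<beta> t + \<tau> - \<rho>) / 2 * (norm (X t \<omega> - prox (X t \<omega>)))\<^sup>2 + 2 * Lc\<^sup>2 / (\<beta> t - \<rho>)) \<partial>S)"
proof -
  obtain Y where Y: "adapted_version t Y" using adapted_version_exists[of t] t by auto
  have Y_comb: "Y (comb_seq t a b) = Y a" for a b using Y by (simp add: adapted_version_def)
  have [measurable]: "X t \<in> borel_measurable S" "X (Suc t) \<in> borel_measurable S"
    using X_meas t by auto
  note step = AE_adapted_step[OF t Y]
  let ?Z = "X (Suc t)"
  let ?C = "\<lambda>x. (\<beta> t + \<tau> - \<rho>) / 2 * (norm (x - prox x))\<^sup>2 + 2 * Lc\<^sup>2 / (\<beta> t - \<rho>)"
  let ?g = "\<lambda>x z. (\<beta> t - \<eta>) / 2 * (norm (prox x - z))\<^sup>2"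
  have "(\<integral>\<^sup>+\<omega>. ennreal (?g (X t \<omega>) (?Z \<omega>)) \<partial>S)
      = (\<integral>\<^sup>+a. \<integral>\<^sup>+s. \<integral>\<^sup>+c. ennreal (?g (X t (comb_seq t a (case_nat s c)))
          (?Z (comb_seq t a (case_nat s c)))) \<partial>S \<partial>M \<partial>S)"
    by (rule seq.nn_integral_split_at) measurable
  also have "\<dots> \<le> (\<integral>\<^sup>+a. ennreal (?C (Y a)) \<partial>S)"
  proof (rule nn_integral_mono_AE, use seq.AE_split_at[OF step(3), of t] step(1,2) in eventually_elim)
    case (elim a)
    define h where "h \<xi> = F (Y a) (prox (Y a)) \<xi> - F (Y a) (Y a) \<xi> - (f (prox (Y a)) - f (Y a))
      + (\<beta> t - \<rho>) / 2 * (norm (Y a - prox (Y a)))\<^sup>2 + (L \<xi> + Lc)\<^sup>2 / (2 * (\<beta> t - \<rho>))" for \<xi>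
    have h: "integrable M h" "(\<integral>\<xi>. h \<xi> \<partial>M) \<le> ?C (Y a)"
      using is_step_prox_bound_integral[OF elim(2) beta[OF t]] unfolding h_def by simp_all
    have bound: "AE s in M. AE c in S. X t (comb_seq t a (case_nat s c)) = Y a
        \<and> ?g (Y a) (?Z (comb_seq t a (case_nat s c))) \<le> h s"
      using elim(1,3) F_lip
    proof eventually_elim
      case elim': (elim s)
      from elim'(1) show ?case
      proof eventually_elim
        case elim'': (elim c)
        then have "is_step (\<beta> t) (Y a) s (?Z (comb_seq t a (case_nat s c)))"
          by (simp add: Y_comb comb_seq_self)
        from is_step_prox_bound[OF elim(2) elim'(2,3) this beta[OF t]] elim''
        show ?case by (simp add: h_def Y_comb)
      qed
    qed
    \<comment> \<open>The formula for \<open>h\<close> shows no sign, but \<open>h s\<close>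
      dominates a squared distance for almost every future, hence for at least one. This permits
      passing from the nonnegative integral to the Bochner integral.\<close>
    have h_nonneg: "AE s in M. 0 \<le> h s"
      using bound
    proof eventually_elim
      case elim': (elim s)
      obtain c where "?g (Y a) (?Z (comb_seq t a (case_nat s c))) \<le> h s"
        using eventually_happens'[OF seq.P.ae_filter_bot elim'] by blast
      moreover have "0 \<le> ?g x z" for x z using eta_less_beta[OF t] by simp
      ultimately show ?case by (blast intro: order_trans)
    qed
    have "(\<integral>\<^sup>+s. \<integral>\<^sup>+c. ennreal (?g (X t (comb_seq t a (case_nat s c)))
          (?Z (comb_seq t a (case_nat s c)))) \<partial>S \<partial>M) \<le> (\<integral>\<^sup>+s. \<integral>\<^sup>+c. ennreal (h s) \<partial>S \<partial>M)"
    proof (rule nn_integral_mono_AE, use bound in eventually_elim)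
      case elim': (elim s)
      show ?case
        by (rule nn_integral_mono_AE, use elim' in eventually_elim) (auto intro: ennreal_leI)
    qed
    also have "\<dots> = (\<integral>\<^sup>+s. ennreal (h s) \<partial>M)"
      by (simp add: seq.P.emeasure_space_1)
    also have "\<dots> = ennreal (\<integral>s. h s \<partial>M)"
      using h(1) h_nonneg by (rule nn_integral_eq_integral)
    also have "\<dots> \<le> ennreal (?C (Y a))" using h(2) by (rule ennreal_leI)
    finally show ?case .
  qed
  also have "\<dots> = (\<integral>\<^sup>+\<omega>. ennreal (?C (X t \<omega>)) \<partial>S)"
    by (rule nn_integral_cong_AE, use step(3) in eventually_elim) simp
  finally show ?thesis .
qed

lemma integrable_prox_displacement:
  assumes "t \<le> Suc T" "integrable S (\<lambda>\<omega>. (norm (X t \<omega> - x0))\<^sup>2)"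
  shows "integrable S (\<lambda>\<omega>. (norm (X t \<omega> - prox (X t \<omega>)))\<^sup>2)"
proof (rule Bochner_Integration.integrable_bound)
  have [measurable]: "X t \<in> borel_measurable S" using assms(1) by (rule X_meas)
  show "(\<lambda>\<omega>. (norm (X t \<omega> - prox (X t \<omega>)))\<^sup>2) \<in> borel_measurable S" by measurable
  show "integrable S (\<lambda>\<omega>. 2 * (norm (x0 - prox x0))\<^sup>2 + 2 * (1 + lipc)\<^sup>2 * (norm (X t \<omega> - x0))\<^sup>2)"
    using assms(2) by simp
qed (use prox_displacement_sq_le[of _ x0] in auto)

lemma prox_distance_integral:
  assumes t: "t \<le> T" and "integrable S (\<lambda>\<omega>. (norm (X t \<omega> - x0))\<^sup>2)"
  shows "integrable S (\<lambda>\<omega>. (norm (prox (X t \<omega>) - X (Suc t) \<omega>))\<^sup>2)"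
    and "(\<beta> t - \<eta>) / 2 * (\<integral>\<omega>. (norm (prox (X t \<omega>) - X (Suc t) \<omega>))\<^sup>2 \<partial>S)
      \<le> (\<beta> t + \<tau> - \<rho>) / 2 * (\<integral>\<omega>. (norm (X t \<omega> - prox (X t \<omega>)))\<^sup>2 \<partial>S) + 2 * Lc\<^sup>2 / (\<beta> t - \<rho>)"
proof -
  let ?z = "\<lambda>\<omega>. (norm (prox (X t \<omega>) - X (Suc t) \<omega>))\<^sup>2"
  let ?d = "\<lambda>\<omega>. (norm (X t \<omega> - prox (X t \<omega>)))\<^sup>2"
  let ?c = "\<lambda>\<omega>. (\<beta> t + \<tau> - \<rho>) / 2 * ?d \<omega> + 2 * Lc\<^sup>2 / (\<beta> t - \<rho>)"
  have [measurable]: "X t \<in> borel_measurable S" "X (Suc t) \<in> borel_measurable S"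
    using X_meas t by auto
  have d: "integrable S ?d" using assms by (intro integrable_prox_displacement) auto
  have c_nonneg: "0 \<le> ?c \<omega>" for \<omega>
    using beta[OF t] tau by (intro add_nonneg_nonneg mult_nonneg_nonneg divide_nonneg_nonneg) auto
  have g_nonneg: "0 \<le> (\<beta> t - \<eta>) / 2 * ?z \<omega>" for \<omega>
    using eta_less_beta[OF t] by simp
  have "(\<integral>\<^sup>+\<omega>. ennreal (?c \<omega>) \<partial>S) = ennreal (\<integral>\<omega>. ?c \<omega> \<partial>S)"
    using d c_nonneg by (intro nn_integral_eq_integral) auto
  with nn_integral_prox_distance_le[OF t]
  have le: "(\<integral>\<^sup>+\<omega>. ennreal ((\<beta> t - \<eta>) / 2 * ?z \<omega>) \<partial>S) \<le> ennreal (\<integral>\<omega>. ?c \<omega> \<partial>S)" by simp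
  have g: "integrable S (\<lambda>\<omega>. (\<beta> t - \<eta>) / 2 * ?z \<omega>)"
    using le g_nonneg by (intro integrableI_nonneg) (auto simp: less_top[symmetric] top_unique)
  then have "integrable S (\<lambda>\<omega>. 2 / (\<beta> t - \<eta>) * ((\<beta> t - \<eta>) / 2 * ?z \<omega>))"
    by (rule integrable_mult_right)
  moreover have "(\<lambda>\<omega>. 2 / (\<beta> t - \<eta>) * ((\<beta> t - \<eta>) / 2 * ?z \<omega>)) = ?z"
    using eta_less_beta[OF t] by simp
  ultimately show "integrable S ?z" by simp
  have "ennreal (\<integral>\<omega>. (\<beta> t - \<eta>) / 2 * ?z \<omega> \<partial>S) \<le> ennreal (\<integral>\<omega>. ?c \<omega> \<partial>S)"
    using le g g_nonneg by (subst (asm) nn_integral_eq_integral) auto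
  then have "(\<integral>\<omega>. (\<beta> t - \<eta>) / 2 * ?z \<omega> \<partial>S) \<le> (\<integral>\<omega>. ?c \<omega> \<partial>S)"
    using c_nonneg by (subst (asm) ennreal_le_iff) (auto intro: integral_nonneg_AE)
  then show "(\<beta> t - \<eta>) / 2 * (\<integral>\<omega>. ?z \<omega> \<partial>S) \<le> (\<beta> t + \<tau> - \<rho>) / 2 * (\<integral>\<omega>. ?d \<omega> \<partial>S) + 2 * Lc\<^sup>2 / (\<beta> t - \<rho>)"
    using d by (simp add: seq.P.prob_space)
qed

text \<open>By induction: the path from \<open>X (Suc t)\<close> to \<open>x0\<close> through
  \<open>prox (X t)\<close> and \<open>X t\<close> has three legs, each square integrable by the
  estimates at time \<open>t\<close>.\<close>

lemma integrable_dist_sq: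
  assumes "t \<le> Suc T"
  shows "integrable S (\<lambda>\<omega>. (norm (X t \<omega> - x0))\<^sup>2)"
  using assms
proof (induction t)
  case 0
  have "integrable S (\<lambda>\<omega>. (norm (X 0 \<omega> - x0))\<^sup>2) \<longleftrightarrow> integrable S (\<lambda>\<omega>. 0 :: real)"
    by (rule Bochner_Integration.integrable_cong) (auto simp: X0)
  then show ?case by simp
next
  case (Suc t)
  then have t: "t \<le> T" and IH: "integrable S (\<lambda>\<omega>. (norm (X t \<omega> - x0))\<^sup>2)" by auto
  let ?z = "\<lambda>\<omega>. norm (prox (X t \<omega>) - X (Suc t) \<omega>)"
  let ?d = "\<lambda>\<omega>. norm (X t \<omega> - prox (X t \<omega>))"
  let ?e = "\<lambda>\<omega>. norm (X t \<omega> - x0)"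
  show ?case
  proof (rule Bochner_Integration.integrable_bound)
    show "integrable S (\<lambda>\<omega>. 3 * ((?z \<omega>)\<^sup>2 + (?d \<omega>)\<^sup>2 + (?e \<omega>)\<^sup>2))"
      using prox_distance_integral(1)[OF t IH] integrable_prox_displacement[OF _ IH] IH t by simp
    have [measurable]: "X (Suc t) \<in> borel_measurable S" using Suc.prems by (rule X_meas)
    show "(\<lambda>\<omega>. (norm (X (Suc t) \<omega> - x0))\<^sup>2) \<in> borel_measurable S" by measurable
    have "(norm (X (Suc t) \<omega> - x0))\<^sup>2 \<le> 3 * ((?z \<omega>)\<^sup>2 + (?d \<omega>)\<^sup>2 + (?e \<omega>)\<^sup>2)" for \<omega>
    proof -
      have "norm (X (Suc t) \<omega> - x0) \<le> ?z \<omega> + ?d \<omega> + ?e \<omega>" by norm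
      then have "(norm (X (Suc t) \<omega> - x0))\<^sup>2 \<le> (?z \<omega> + ?d \<omega> + ?e \<omega>)\<^sup>2" by (intro power_mono) auto
      also have "\<dots> \<le> 3 * ((?z \<omega>)\<^sup>2 + (?d \<omega>)\<^sup>2 + (?e \<omega>)\<^sup>2)"
        using sum_squares_bound[of "?z \<omega>" "?d \<omega>"] sum_squares_bound[of "?z \<omega>" "?e \<omega>"]
          sum_squares_bound[of "?d \<omega>" "?e \<omega>"] by (simp add: power2_eq_square algebra_simps)
      finally show ?thesis .
    qed
    then show "AE \<omega> in S. norm ((norm (X (Suc t) \<omega> - x0))\<^sup>2)
        \<le> norm (3 * ((?z \<omega>)\<^sup>2 + (?d \<omega>)\<^sup>2 + (?e \<omega>)\<^sup>2))"
      by simp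
  qed
qed

lemma integrable_env:
  assumes "t \<le> Suc T"
  shows "integrable S (\<lambda>\<omega>. env (X t \<omega>))"
proof (rule Bochner_Integration.integrable_bound)
  have [measurable]: "X t \<in> borel_measurable S" using assms by (rule X_meas)
  show "(\<lambda>\<omega>. env (X t \<omega>)) \<in> borel_measurable S" by measurable
  show "integrable S (\<lambda>\<omega>. \<bar>env x0\<bar> + \<rho> * (norm (x0 - prox x0))\<^sup>2 + \<rho> * (2 + lipc) * (norm (X t \<omega> - x0))\<^sup>2)"
    using integrable_dist_sq[OF assms] by simp
qed (use order_trans[OF abs_env_le abs_ge_self] in auto)

section \<open>Expected descent of the envelope and its summation\<close>

definition mean_grad_sq :: "nat \<Rightarrow> real" where
  "mean_grad_sq t = (\<integral>\<omega>. (norm (grad env (X t \<omega>)))\<^sup>2 \<partial>S)"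

lemma mean_grad_sq_eq: "mean_grad_sq t = \<rho>\<^sup>2 * (\<integral>\<omega>. (norm (X t \<omega> - prox (X t \<omega>)))\<^sup>2 \<partial>S)"
  by (simp add: mean_grad_sq_def grad_env power_mult_distrib)

lemma expected_descent:
  assumes t: "t \<le> T"
  shows "(\<integral>\<omega>. env (X (Suc t) \<omega>) \<partial>S) \<le> (\<integral>\<omega>. env (X t \<omega>) \<partial>S)
    - (\<rho> - \<tau> - \<eta>) / (2 * \<rho> * (\<beta> t - \<eta>)) * mean_grad_sq t
    + 2 * \<rho> * Lc\<^sup>2 / ((\<beta> t - \<eta>) * (\<beta> t - \<rho>))"
proof -
  define Z where "Z = (\<integral>\<omega>. (norm (prox (X t \<omega>) - X (Suc t) \<omega>))\<^sup>2 \<partial>S)"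
  define D where "D = (\<integral>\<omega>. (norm (X t \<omega> - prox (X t \<omega>)))\<^sup>2 \<partial>S)"
  have J: "integrable S (\<lambda>\<omega>. (norm (X t \<omega> - x0))\<^sup>2)" using t by (intro integrable_dist_sq) simp
  note [simp] = prox_distance_integral(1)[OF t J] integrable_prox_displacement[OF _ J]
    integrable_env
  have "(\<integral>\<omega>. env (X (Suc t) \<omega>) \<partial>S) \<le> (\<integral>\<omega>. env (X t \<omega>)
      - \<rho> / 2 * (norm (X t \<omega> - prox (X t \<omega>)))\<^sup>2 + \<rho> / 2 * (norm (prox (X t \<omega>) - X (Suc t) \<omega>))\<^sup>2 \<partial>S)"
    using t env_descent by (intro integral_mono) auto
  also have "\<dots> = (\<integral>\<omega>. env (X t \<omega>) \<partial>S) - \<rho> / 2 * D + \<rho> / 2 * Z"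
    using t by (simp add: Z_def D_def)
  also have "Z \<le> ((\<beta> t + \<tau> - \<rho>) * D + 4 * Lc\<^sup>2 / (\<beta> t - \<rho>)) / (\<beta> t - \<eta>)"
    using prox_distance_integral(2)[OF t J, folded Z_def D_def] eta_less_beta[OF t]
    by (simp add: pos_le_divide_eq field_simps)
  also have "(\<integral>\<omega>. env (X t \<omega>) \<partial>S) - \<rho> / 2 * D
      + \<rho> / 2 * (((\<beta> t + \<tau> - \<rho>) * D + 4 * Lc\<^sup>2 / (\<beta> t - \<rho>)) / (\<beta> t - \<eta>))
      = (\<integral>\<omega>. env (X t \<omega>) \<partial>S) - (\<rho> - \<tau> - \<eta>) / (2 * \<rho> * (\<beta> t - \<eta>)) * (\<rho>\<^sup>2 * D)
        + 2 * \<rho> * Lc\<^sup>2 / ((\<beta> t - \<eta>) * (\<beta> t - \<rho>))"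
  proof -
    define p q where "p = \<beta> t - \<eta>" and "q = \<beta> t - \<rho>"
    have pq: "p > 0" "q > 0" using eta_less_beta[OF t] beta[OF t] by (auto simp: p_def q_def)
    \<comment> \<open>After division by \<open>p\<close>, the first summand cancels the term
      \<open>- \<rho> / 2 * D\<close>; the second one yields the decrease.\<close>
    have e: "\<beta> t + \<tau> - \<rho> = p - (\<rho> - \<tau> - \<eta>)" by (simp add: p_def)
    show ?thesis
      unfolding e p_def[symmetric] q_def[symmetric] using pq rho_pos
      by (simp add: field_simps power2_eq_square)
  qed
  finally show ?thesis using rho_pos by (simp add: mean_grad_sq_eq D_def)
qed

text \<open>Multiplied by \<open>2 * \<rho>\<close>, the descent inequality carries the sampling
  weight in front of the squared gradient. The envelope differences telescope, and the last mean
  envelope is at least the infimum \<open>m\<close>.\<close>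

lemma weighted_mean_grad_sq_le:
  fixes m :: real
  assumes m: "(INF x. \<phi> x) = ereal m"
  shows "(\<Sum>t\<le>T. (\<rho> - \<tau> - \<eta>) / (\<beta> t - \<eta>) * mean_grad_sq t)
    \<le> 2 * (\<rho> * (env x0 - m) + 2 * \<rho>\<^sup>2 * Lc\<^sup>2 * (\<Sum>t\<le>T. 1 / ((\<beta> t - \<eta>) * (\<beta> t - \<rho>))))"
proof -
  define e where "e t = (\<integral>\<omega>. env (X t \<omega>) \<partial>S)" for t
  have "(\<Sum>t\<le>T. (\<rho> - \<tau> - \<eta>) / (\<beta> t - \<eta>) * mean_grad_sq t)
      \<le> (\<Sum>t\<le>T. 2 * \<rho> * (e t - e (Suc t)) + 4 * \<rho>\<^sup>2 * Lc\<^sup>2 * (1 / ((\<beta> t - \<eta>) * (\<beta> t - \<rho>))))"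
  proof (rule sum_mono)
    fix t assume "t \<in> {..T}"
    then have "(\<rho> - \<tau> - \<eta>) / (2 * \<rho> * (\<beta> t - \<eta>)) * mean_grad_sq t
        \<le> e t - e (Suc t) + 2 * \<rho> * Lc\<^sup>2 / ((\<beta> t - \<eta>) * (\<beta> t - \<rho>))"
      using expected_descent[of t] by (simp add: e_def)
    then have "2 * \<rho> * ((\<rho> - \<tau> - \<eta>) / (2 * \<rho> * (\<beta> t - \<eta>)) * mean_grad_sq t)
        \<le> 2 * \<rho> * (e t - e (Suc t) + 2 * \<rho> * Lc\<^sup>2 / ((\<beta> t - \<eta>) * (\<beta> t - \<rho>)))"
      using rho_pos by (intro mult_left_mono) auto
    also have "2 * \<rho> * ((\<rho> - \<tau> - \<eta>) / (2 * \<rho> * (\<beta> t - \<eta>)) * mean_grad_sq t)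
        = (\<rho> - \<tau> - \<eta>) / (\<beta> t - \<eta>) * mean_grad_sq t"
      using rho_pos by simp
    finally show "(\<rho> - \<tau> - \<eta>) / (\<beta> t - \<eta>) * mean_grad_sq t
        \<le> 2 * \<rho> * (e t - e (Suc t)) + 4 * \<rho>\<^sup>2 * Lc\<^sup>2 * (1 / ((\<beta> t - \<eta>) * (\<beta> t - \<rho>)))"
      by (simp add: distrib_left power2_eq_square mult_ac)
  qed
  also have "\<dots> = 2 * \<rho> * (e 0 - e (Suc T)) + 4 * \<rho>\<^sup>2 * Lc\<^sup>2 * (\<Sum>t\<le>T. 1 / ((\<beta> t - \<eta>) * (\<beta> t - \<rho>)))"
    unfolding sum.distrib sum_distrib_left[symmetric] lessThan_Suc_atMost[symmetric] sum_lessThan_telescope' ..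
  also have "e 0 = env x0"
  proof -
    have "e 0 = (\<integral>\<omega>. env x0 \<partial>S)"
      unfolding e_def by (intro Bochner_Integration.integral_cong) (simp_all add: X0)
    then show ?thesis by (simp add: seq.P.prob_space)
  qed
  also have "2 * \<rho> * (env x0 - e (Suc T)) \<le> 2 * \<rho> * (env x0 - m)"
  proof -
    have "m \<le> env x" for x using INF_le_env[of x] by (simp add: m)
    then have "(\<integral>\<omega>. m \<partial>S) \<le> e (Suc T)"
      unfolding e_def by (intro integral_mono integrable_env) auto
    then have "m \<le> e (Suc T)" by (simp add: seq.P.prob_space)
    then show ?thesis using rho_pos by simp
  qed
  finally show ?thesis by (simp add: algebra_simps)
qed

text \<open>A finite envelope value excludes the infimum plus infinity. If it is minus infinity, the
  right-hand sides of the final bounds are infinite and the bounds are trivial.\<close>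

lemma INF_phi_cases:
  obtains "(INF x. \<phi> x) = -\<infinity>" | m where "(INF x. \<phi> x) = ereal m"
  using INF_le_env[of x0] by (cases "INF x. \<phi> x") auto

text \<open>The unnormalized probability of drawing the index \<open>t\<close>.\<close>

definition weight :: "nat \<Rightarrow> real" where
  "weight t = (\<rho> - \<tau> - \<eta>) / (\<beta> t - \<eta>)"

lemma weight_sum_pos: "0 < (\<Sum>t\<le>T. weight t)"
  using rho eta_less_beta by (intro sum_pos) (auto simp: weight_def)

lemma mean_grad_sq_at_random_index:
  "ereal (\<Sum>t\<le>T. weight t / (\<Sum>s\<le>T. weight s) * mean_grad_sq t)
    \<le> (ereal \<rho> * (moreau_env \<phi> (1 / \<rho>) x0 - (INF x. \<phi> x))
        + ereal (2 * \<rho>\<^sup>2 * Lc\<^sup>2 * (\<Sum>t\<le>T. 1 / ((\<beta> t - \<eta>) * (\<beta> t - \<rho>)))))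
      / ereal (\<Sum>t\<le>T. (\<rho> - \<tau> - \<eta>) / (2 * (\<beta> t - \<eta>)))"
proof -
  let ?W = "\<Sum>t\<le>T. weight t"
  \<comment> \<open>The denominator is half the normalizing constant, which accounts for the factor
    2 in \<open>weighted_mean_grad_sq_le\<close>.\<close>
  have W: "(\<Sum>t\<le>T. (\<rho> - \<tau> - \<eta>) / (2 * (\<beta> t - \<eta>))) = ?W / 2"
    unfolding sum_divide_distrib by (simp add: weight_def mult.commute)
  show ?thesis
  proof (cases rule: INF_phi_cases)
    case 1
    then show ?thesis
      unfolding W using weight_sum_pos rho_pos
      by (simp add: moreau_env_eq_env)
  next
    case (2 m)
    have "(\<Sum>t\<le>T. weight t / ?W * mean_grad_sq t) = (\<Sum>t\<le>T. weight t * mean_grad_sq t) / ?W"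
      by (simp add: sum_divide_distrib)
    also have "\<dots> \<le> 2 * (\<rho> * (env x0 - m) + 2 * \<rho>\<^sup>2 * Lc\<^sup>2 * (\<Sum>t\<le>T. 1 / ((\<beta> t - \<eta>) * (\<beta> t - \<rho>)))) / ?W"
      using weighted_mean_grad_sq_le[OF 2] weight_sum_pos
      by (intro divide_right_mono) (auto simp: weight_def)
    finally show ?thesis
      unfolding W 2 moreau_env_eq_env using weight_sum_pos by (simp add: mult.commute)
  qed
qed

lemma mean_grad_sq_at_random_index_constant:
  assumes \<gamma>: "\<gamma> > 0" and \<beta>: "\<And>t. t \<le> T \<Longrightarrow> \<beta> t = \<rho> + sqrt (real T + 1) / \<gamma>"
  shows "ereal (\<Sum>t\<le>T. weight t / (\<Sum>s\<le>T. weight s) * mean_grad_sq t)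
    \<le> ereal 2 * (ereal \<rho> * (moreau_env \<phi> (1 / \<rho>) x0 - (INF x. \<phi> x)) + ereal (2 * \<rho>\<^sup>2 * Lc\<^sup>2 * \<gamma>\<^sup>2))
      / ereal (\<rho> - \<tau> - \<eta>) * ereal ((\<rho> - \<eta>) / (real T + 1) + 1 / (\<gamma> * sqrt (real T + 1)))"
proof -
  define q where "q = sqrt (real T + 1)"
  have q: "q > 0" "q\<^sup>2 = real T + 1" by (auto simp: q_def)
  define p where "p = \<rho> - \<eta>"
  have p: "p > 0" using rho tau by (simp add: p_def)
  define k where "k = \<rho> - \<tau> - \<eta>"
  have k: "k > 0" using rho by (simp add: k_def)
  have b\<rho>: "\<beta> t - \<rho> = q / \<gamma>" and b\<eta>: "\<beta> t - \<eta> = p + q / \<gamma>" if "t \<le> T" for t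
    using \<beta>[OF that] by (simp_all add: p_def q_def)
  have factor: "(\<rho> - \<eta>) / (real T + 1) + 1 / (\<gamma> * sqrt (real T + 1)) = (p + q / \<gamma>) / q\<^sup>2"
    unfolding p_def[symmetric] q_def[symmetric] q(2)[symmetric] using q(1) \<gamma>
    by (simp add: field_simps power2_eq_square)
  have pq: "p + q / \<gamma> > 0" using p q(1) \<gamma> by (simp add: add_pos_pos)
  show ?thesis
  proof (cases rule: INF_phi_cases)
    case 1
    then show ?thesis
      unfolding factor k_def[symmetric] using k pq q(1) rho_pos
      by (simp add: moreau_env_eq_env)
  next
    case (2 m)
    have "(\<Sum>t\<le>T. 1 / ((\<beta> t - \<eta>) * (\<beta> t - \<rho>))) = (\<Sum>t\<le>T. 1 / ((p + q / \<gamma>) * (q / \<gamma>)))"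
      by (intro sum.cong) (auto simp: b\<rho> b\<eta>)
    \<comment> \<open>There are \<open>T + 1 = q^2\<close> equal summands.\<close>
    also have "\<dots> = q\<^sup>2 / ((p + q / \<gamma>) * (q / \<gamma>))"
      using q(2) by simp
    \<comment> \<open>Dropping the positive \<open>p\<close> from the first factor of the
      denominator leaves exactly \<open>\<gamma>^2\<close>.\<close>
    also have "\<dots> \<le> q\<^sup>2 / ((q / \<gamma>) * (q / \<gamma>))"
      using p q(1) \<gamma> by (intro divide_left_mono mult_right_mono mult_pos_pos add_pos_pos) auto
    also have "\<dots> = \<gamma>\<^sup>2" using q(1) \<gamma> by (simp add: field_simps power2_eq_square)
    finally have le: "(\<Sum>t\<le>T. 1 / ((\<beta> t - \<eta>) * (\<beta> t - \<rho>))) \<le> \<gamma>\<^sup>2" .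
    define W where "W = k * q\<^sup>2 / (2 * (p + q / \<gamma>))"
    have "(\<Sum>t\<le>T. (\<rho> - \<tau> - \<eta>) / (2 * (\<beta> t - \<eta>))) = (\<Sum>t\<le>T. k / (2 * (p + q / \<gamma>)))"
      by (intro sum.cong) (auto simp: b\<eta> k_def)
    also have "\<dots> = k * q\<^sup>2 / (2 * (p + q / \<gamma>))" using q(2) by simp
    finally have W: "(\<Sum>t\<le>T. (\<rho> - \<tau> - \<eta>) / (2 * (\<beta> t - \<eta>))) = W" unfolding W_def .
    have W_pos: "W > 0" using k q(1) pq by (simp add: W_def)
    let ?A = "\<rho> * (env x0 - m) + 2 * \<rho>\<^sup>2 * Lc\<^sup>2 * (\<Sum>t\<le>T. 1 / ((\<beta> t - \<eta>) * (\<beta> t - \<rho>)))"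
    let ?B = "\<rho> * (env x0 - m) + 2 * \<rho>\<^sup>2 * Lc\<^sup>2 * \<gamma>\<^sup>2"
    have "(\<Sum>t\<le>T. weight t / (\<Sum>s\<le>T. weight s) * mean_grad_sq t) \<le> ?A / W"
      using mean_grad_sq_at_random_index W_pos unfolding W 2 moreau_env_eq_env by simp
    also have "\<dots> \<le> ?B / W"
      using le W_pos by (intro divide_right_mono add_left_mono mult_left_mono) auto
    also have "\<dots> = 2 * ?B / k * ((p + q / \<gamma>) / q\<^sup>2)"
    proof -
      have "c / (k * q\<^sup>2 / (2 * d)) = 2 * c / k * (d / q\<^sup>2)" for c d :: real by simp
      then show ?thesis unfolding W_def .
    qed
    finally show ?thesis
      unfolding factor k_def[symmetric] 2 moreau_env_eq_env using k by simp
  qed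
qed

end

text \<open>The random index is independent of the samples, so its expectation is the weighted
  average \<open>Gstar\<close>. The last two bounds are stated in \<open>ereal\<close> because the
  infimum of \<open>\<phi>\<close> may be minus infinity. The samples are the coordinates of a
  sequence drawn from the product measure, and each iterate is a given measurable function of it
  that almost surely minimizes the step objective.\<close>

theorem theorem4p3:
  fixes r :: "'a::euclidean_space \<Rightarrow> ereal" and f :: "'a \<Rightarrow> real"
    and M :: "'w measure" and U :: "'a set"
    and F :: "'a \<Rightarrow> 'a \<Rightarrow> 'w \<Rightarrow> real" and L :: "'w \<Rightarrow> real"
    and \<tau> \<eta> Lc \<rho> :: real and T :: nat and \<beta> :: "nat \<Rightarrow> real" and x0 :: 'a
    and X :: "nat \<Rightarrow> (nat \<Rightarrow> 'w) \<Rightarrow> 'a"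
  assumes r_closed: "closed_fun r"
    and r_proper: "\<forall>x. r x \<noteq> -\<infinity>" "\<exists>x. r x < \<infinity>"
    and f_lip: "locally_lipschitz f"
    and tau: "\<tau> \<ge> 0" and Lc: "Lc \<ge> 0"
    (* (B1) *)
    and M: "prob_space M"
    (* (B2) *)
    and U: "open U" "convex U" "dom_fun r \<subseteq> U"
    and F_meas: "(\<lambda>(p, w). F (fst p) (snd p) w) \<in>
                   borel_measurable (restrict_space borel (U \<times> U) \<Otimes>\<^sub>M M)"
    and B2a: "\<forall>x\<in>U. integrable M (F x x) \<and> (\<integral>\<xi>. F x x \<xi> \<partial>M) = f x"
    and B2b: "\<forall>x\<in>U. \<forall>y\<in>U. integrable M (F x y) \<and>
                 (\<integral>\<xi>. F x y \<xi> - f y \<partial>M) \<le> \<tau> / 2 * (norm (y - x))\<^sup>2"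
    (* (B3) *)
    and B3: "\<forall>x\<in>U. AE \<xi> in M. weakly_convex \<eta> (\<lambda>y. ereal (F x y \<xi>) + r y)"
    (* (B4) *)
    and L_meas: "L \<in> borel_measurable M" and L_nonneg: "\<forall>\<xi>\<in>space M. L \<xi> \<ge> 0"
    and L_sq: "integrable M (\<lambda>\<xi>. (L \<xi>)\<^sup>2)" "sqrt (\<integral>\<xi>. (L \<xi>)\<^sup>2 \<partial>M) \<le> Lc"
    and B4: "AE \<xi> in M. \<forall>x\<in>U. \<forall>y\<in>U. F x x \<xi> - F x y \<xi> \<le> L \<xi> * norm (x - y)"
    (* parameters *)
    and rho: "\<rho> > max (\<tau> + \<eta>) 0"
    and beta: "\<forall>t\<le>T. \<beta> t > \<rho>"
    and x0: "x0 \<in> U"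
    (* the iterates, driven by xi_t = omega t, omega ~ M^N (i.i.d.) *)
    and X0: "\<forall>\<omega>\<in>space (\<Pi>\<^sub>M i\<in>UNIV. M). X 0 \<omega> = x0"
    and X_meas: "\<forall>t\<le>Suc T. X t \<in> borel_measurable (\<Pi>\<^sub>M i\<in>UNIV. M)"
    and X_step: "\<forall>t\<le>T. AE \<omega> in (\<Pi>\<^sub>M i\<in>UNIV. M). \<forall>y.
          r (X (Suc t) \<omega>) + ereal (F (X t \<omega>) (X (Suc t) \<omega>) (\<omega> t))
            + ereal (\<beta> t / 2 * (norm (X (Suc t) \<omega> - X t \<omega>))\<^sup>2)
          \<le> r y + ereal (F (X t \<omega>) y (\<omega> t)) + ereal (\<beta> t / 2 * (norm (y - X t \<omega>))\<^sup>2)"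
  shows
   "let S = (\<Pi>\<^sub>M i\<in>UNIV. M);
        \<phi> = (\<lambda>x. ereal (f x) + r x);
        env = (\<lambda>x. real_of_ereal (moreau_env \<phi> (1 / \<rho>) x));
        G = (\<lambda>t. \<integral>\<omega>. (norm (grad env (X t \<omega>)))\<^sup>2 \<partial>S);
        w = (\<lambda>t. (\<rho> - \<tau> - \<eta>) / (\<beta> t - \<eta>));
        Gstar = (\<Sum>t\<le>T. w t / (\<Sum>s\<le>T. w s) * G t)
    in (\<forall>t\<le>T.
          (\<integral>\<omega>. env (X (Suc t) \<omega>) \<partial>S)
            \<le> (\<integral>\<omega>. env (X t \<omega>) \<partial>S)
               - (\<rho> - \<tau> - \<eta>) / (2 * \<rho> * (\<beta> t - \<eta>)) * G t
               + 2 * \<rho> * Lc\<^sup>2 / ((\<beta> t - \<eta>) * (\<beta> t - \<rho>)))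
     \<and> ereal Gstar
         \<le> (ereal \<rho> * (moreau_env \<phi> (1 / \<rho>) x0 - (INF x. \<phi> x))
             + ereal (2 * \<rho>\<^sup>2 * Lc\<^sup>2 * (\<Sum>t\<le>T. 1 / ((\<beta> t - \<eta>) * (\<beta> t - \<rho>)))))
           / ereal (\<Sum>t\<le>T. (\<rho> - \<tau> - \<eta>) / (2 * (\<beta> t - \<eta>)))
     \<and> (\<forall>\<gamma>>0. (\<forall>t\<le>T. \<beta> t = \<rho> + sqrt (real T + 1) / \<gamma>) \<longrightarrow>
          ereal Gstar
            \<le> ereal 2 * (ereal \<rho> * (moreau_env \<phi> (1 / \<rho>) x0 - (INF x. \<phi> x))
                          + ereal (2 * \<rho>\<^sup>2 * Lc\<^sup>2 * \<gamma>\<^sup>2))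
                / ereal (\<rho> - \<tau> - \<eta>)
                * ereal ((\<rho> - \<eta>) / (real T + 1) + 1 / (\<gamma> * sqrt (real T + 1))))"
proof -
  interpret stochastic_model M r f U F L \<tau> \<eta> Lc \<rho>
    by (intro stochastic_model.intro stochastic_model_axioms.intro
        M r_closed f_lip tau U(2,3) L_meas L_sq B4 rho)
      (use r_proper B2a B2b B3 in blast)+
  interpret stochastic_prox_method M r f U F L \<tau> \<eta> Lc \<rho> T \<beta> x0 X
    by (intro stochastic_prox_method.intro stochastic_prox_method_axioms.intro
        stochastic_model_axioms x0)
      (use beta X0 X_meas X_step in \<open>simp_all add: is_step_def\<close>)
  show ?thesis
    unfolding Let_def env_def[symmetric] mean_grad_sq_def[symmetric] weight_def[symmetric]
    by (intro conjI allI impI expected_descent mean_grad_sq_at_random_index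
        mean_grad_sq_at_random_index_constant) auto
qed

end
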